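(* In the setting described in the context, with all standing assumptions in force, let $\{(\mathbf x_{(i,:)}^t)_{i=1}^N\}_{t\ge0}$ be generated by the block-wise algorithm. Then: (i) (consensus) $\lim_{t\to\infty}\|\mathbf x_{(i,:)}^t-\bar{\mathbf s}^t\|=0$ for every $i\in\{1,\dots,N\}$; (ii) (convergence) the sequence $\{\bar{\mathbf s}^t\}_{t\ge0}$ is bounded, and every limit point of it is a stationary solution of problem (P).
   Context: Problem. Let $N,B,d\ge1$. A vector $\mathbf x\in\mathbb R^{dB}$ is partitioned into blocks $\mathbf x=(\mathbf x_1,\dots,\mathbf x_B)$ with $\mathbf x_\ell\in\mathbb R^d$, and $\nabla_\ell$ denotes the partial gradient with respect to block $\ell$. Problem (P) is $$\min_{\mathbf x}\ U(\mathbf x)=\sum_{i=1}^Nf_i(\mathbf x)+\sum_{\ell=1}^B r_\ell(\mathbf x_\ell)\quad\text{s.t. }\mathbf x_\ell\in\mathcal K_\ell,\ \ell=1,\dots,B,$$ with $\mathcal K=\mathcal K_1\times\dots\times\mathcal K_B$. Problem assumptions: - each $\mathcal K_\ell\subseteq\mathbb R^d$ is nonempty, closed and convex; - each $f_i:\mathbb R^{dB}\to\mathbb R$ is $C^1$ on an open set containing $\mathcal K$, and $\nabla f_i$ is $L_i$-Lipschitz continuous and bounded on $\mathcal K$; - each $r_\ell:\mathbb R^d\to\mathbb R$ is convex with bounded subgradients on $\mathcal K_\ell$; - $U$ is coercive on $\mathcal K$. A point $\mathbf x^*\in\mathcal K$ is a stationary solution of (P) if $$\sum_{\ell=1}^B\Big[\big(\textstyle\sum_i\nabla_\ell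 f_i(\mathbf x^* )\big)^\top(\mathbf x_\ell-\mathbf x^*_\ell)+r_\ell(\mathbf x_\ell)-r_\ell(\mathbf x^*_\ell)\Big]\ge0\quad\text{for all }\mathbf x\in\mathcal K.$$ Network. $\mathcal G=(\{1,\dots,N\},\mathcal E)$ is a fixed, strongly connected digraph containing all self-loops. The in-neighbor set of $i$ is $\mathcal N_i=\{j:(j,i)\in\mathcal E\}$. Block selection. At each iteration $t\ge0$, agent $i$ picks $\ell_i^t\in\{1,\dots,B\}$. For each $i$ there is a finite $T_i>0$ with $\bigcup_{\tau=0}^{T_i-1}\{\ell_i^{t+\tau}\}=\{1,\dots,B\}$ for all $t\ge0$. Define $\mathcal N_{i,\ell}^t=\{j\in\mathcal N_i:\ell_j^t=\ell\}\cup\{i\}$ and $\mathcal E_\ell^t=\{(j,i)\in\mathcal E:j\in\mathcal N_{i,\ell}^t\}$. Weights. For each $\ell$ and $t$, $A_\ell^t=[a_{ij\ell}^t]$ satisfies $a_{ij\ell}^t>\kappa$ if $(j,i)\in\mathcal E_\ell^t$, $a_{ij\ell}^t=0$ otherwise (for a fixed $\kappa>0$), and $\mathbf 1^\top A_\ell^t=\mathbf 1^\top$. Surrogates. For each $i,\ell$, $\tilde f_{i,\ell}:\mathcal K_\ell\times\mathcal K\to\mathbb R$ satisfies: - $\tilde f_{i,\ell}(\cdot;\mathbf x)$ is $C^1$ and $\tau_i$-strongly convex on $\mathcal K_\ell$ uniformly in $\mathbf x\in\mathcal K$, with $\tau_i>0$; - $\nabla\tilde f_{i,\ell}(\mathbf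 x_\ell;\mathbf x)=\nabla_\ell f_i(\mathbf x)$ for all $\mathbf x\in\mathcal K$, where $\nabla\tilde f_{i,\ell}$ is the gradient in the first argument and $\mathbf x_\ell$ is the $\ell$-th block of $\mathbf x$; - $\nabla\tilde f_{i,\ell}(\mathbf z;\cdot)$ is Lipschitz continuous on $\mathcal K$ uniformly in $\mathbf z\in\mathcal K_\ell$. For $\mathbf w\in\mathcal K$ and $\mathbf g\in\mathbb R^d$ let $$\hat f_{i,\ell}(\mathbf z;\mathbf w,\mathbf g)=\tilde f_{i,\ell}(\mathbf z;\mathbf w)+(N\mathbf g-\nabla_\ell f_i(\mathbf w))^\top(\mathbf z-\mathbf w_\ell).$$ Step sizes. $0<\gamma^t\le1$, $\gamma^{t+1}\le\gamma^t$, $\sum_t\gamma^t=\infty$, $\sum_t(\gamma^t)^2<\infty$. Algorithm. Agent $i$ holds $\mathbf x_{(i,:)}^t=(\mathbf x_{(i,\ell)}^t)_\ell$, $\mathbf y_{(i,:)}^t=(\mathbf y_{(i,\ell)}^t)_\ell$ in $\mathbb R^{dB}$ and scalars $\phi_{(i,\ell)}^t$. Initialization: $\mathbf x_{(i,:)}^0\in\mathcal K$ arbitrary, $\mathbf y_{(i,:)}^0=\nabla f_i(\mathbf x_{(i,:)}^0)$, $\phi_{(i,\ell)}^0=1$. At iteration $t$, each agent $i$: - computes $\tilde{\mathbf x}_{(i,\ell_i^t)}^t=\arg\min_{\mathbf z\in\mathcal K_{\ell_i^t}}\hat f_{i,\ell_i^t}(\mathbf z;\mathbf x_{(i,:)}^t,\mathbf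 y_{(i,\ell_i^t)}^t)+r_{\ell_i^t}(\mathbf z)$; - sets $\Delta\mathbf x_{(i,\ell)}^t=\tilde{\mathbf x}_{(i,\ell)}^t-\mathbf x_{(i,\ell)}^t$ if $\ell=\ell_i^t$ and $\Delta\mathbf x_{(i,\ell)}^t=\mathbf 0$ otherwise; - for every $\ell$ updates $$\phi_{(i,\ell)}^{t+1}=\sum_{j\in\mathcal N_{i,\ell}^t}a_{ij\ell}^t\phi_{(j,\ell)}^t,\qquad \mathbf x_{(i,\ell)}^{t+1}=\sum_{j\in\mathcal N_{i,\ell}^t}\frac{a_{ij\ell}^t\phi_{(j,\ell)}^t}{\phi_{(i,\ell)}^{t+1}}\big(\mathbf x_{(j,\ell)}^t+\gamma^t\Delta\mathbf x_{(j,\ell)}^t\big),$$ $$\mathbf y_{(i,\ell)}^{t+1}=\sum_{j\in\mathcal N_{i,\ell}^t}\frac{a_{ij\ell}^t}{\phi_{(i,\ell)}^{t+1}}\Big(\phi_{(j,\ell)}^t\mathbf y_{(j,\ell)}^t+\nabla_\ell f_j(\mathbf x_{(j,:)}^{t+1})-\nabla_\ell f_j(\mathbf x_{(j,:)}^t)\Big).$$ Weighted average: $\bar{\mathbf s}^t=\frac1N\big(\sum_{i=1}^N\phi_{(i,\ell)}^t\mathbf x_{(i,\ell)}^t\big)_{\ell=1}^B$. *)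

theory Defs
  imports "HOL-Analysis.Analysis"
begin

text \<open>Vectors of R^{dB} are modelled as real^'d^'b: blocks are indexed by the finite type 'b
  (B = CARD('b)), each block lives in real^'d (d = CARD('d)). Agents are indexed by the
  finite type 'a (N = CARD('a)).\<close>

definition strongly_convex_on :: "real \<Rightarrow> 'v::real_inner set \<Rightarrow> ('v \<Rightarrow> real) \<Rightarrow> bool" where
  "strongly_convex_on c S f \<longleftrightarrow> convex_on S (\<lambda>z. f z - (c / 2) * (norm z)\<^sup>2)"

definition is_subgradient :: "('v::real_inner \<Rightarrow> real) \<Rightarrow> 'v \<Rightarrow> 'v \<Rightarrow> bool" where
  "is_subgradient r z g \<longleftrightarrow> (\<forall>y. r y \<ge> r z + inner g (y - z))"

definition coercive_on :: "'v::real_normed_vector set \<Rightarrow> ('v \<Rightarrow> real) \<Rightarrow> bool" where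
  "coercive_on S U \<longleftrightarrow> (\<forall>M. \<exists>R. \<forall>x\<in>S. norm x \<ge> R \<longrightarrow> U x \<ge> M)"

definition prod_set :: "('b::finite \<Rightarrow> (real^'d) set) \<Rightarrow> (real^'d^'b) set" where
  "prod_set Kb = {x. \<forall>l. x $ l \<in> Kb l}"

definition nbr_block :: "('a \<times> 'a) set \<Rightarrow> ('a \<Rightarrow> 'b) \<Rightarrow> 'a \<Rightarrow> 'b \<Rightarrow> 'a set" where
  "nbr_block E sel i l = {j. (j, i) \<in> E \<and> sel j = l} \<union> {i}"

definition edges_block :: "('a \<times> 'a) set \<Rightarrow> ('a \<Rightarrow> 'b) \<Rightarrow> 'b \<Rightarrow> ('a \<times> 'a) set" where
  "edges_block E sel l = {(j, i). (j, i) \<in> E \<and> j \<in> nbr_block E sel i l}"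

text \<open>Stationary solution of (P); gf i is the gradient of f i, Kb l the block constraint sets.\<close>
definition stationary :: "('a::finite \<Rightarrow> real^'d^'b \<Rightarrow> real^'d^'b) \<Rightarrow> ('b::finite \<Rightarrow> real^'d \<Rightarrow> real)
     \<Rightarrow> ('b \<Rightarrow> (real^'d) set) \<Rightarrow> real^'d^'b \<Rightarrow> bool" where
  "stationary gf r Kb xs \<longleftrightarrow> xs \<in> prod_set Kb \<and>
     (\<forall>x\<in>prod_set Kb. (\<Sum>l\<in>UNIV. inner (\<Sum>i\<in>UNIV. gf i xs $ l) (x $ l - xs $ l)
                                   + r l (x $ l) - r l (xs $ l)) \<ge> 0)"

end

theory Submission
  imports Defs
begin

text \<open>
  Blockwise, the algorithm is a perturbed consensus iteration for both the iterates and the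
  gradient trackers: after rescaling by \<open>\<Phi>\<close> the mixing matrices are row stochastic, and their
  products over a fixed number of steps are uniformly positive, hence contract the spread between
  the agents. The trackers are bounded because the gradients are, so the search directions \<open>\<Delta>\<close> are
  bounded and the perturbations of the iterates are \<open>O(\<gamma> t)\<close>, hence square summable; this passes to
  the disagreement of the iterates and then to that of the trackers. All error terms in the descent
  inequality are therefore summable, so \<open>sbar\<close> stays in a level set of the objective and
  \<open>\<gamma> t * (norm (\<Delta> t j l))\<^sup>2\<close> is summable.

  To reach blocks that are not selected at time \<open>t\<close>, \<open>\<Delta>\<close> is compared with the residual of the
  exact best response at \<open>sbar t\<close>, a Lipschitz function of the point. Every block is selected within
  a bounded window, so the \<open>\<gamma>\<close>-weighted squared residuals of all blocks are summable, and slow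
  variation forces the residuals to \<open>0\<close>. A zero of the residual is a stationary point.
\<close>

section \<open>Real sequences\<close>

lemma summable_of_delayed_contraction:
  fixes a b :: "nat \<Rightarrow> real"
  assumes a_nonneg: "\<And>t. 0 \<le> a t" and b_nonneg: "\<And>t. 0 \<le> b t" and b_summable: "summable b"
    and q_less_1: "q < 1"
    and contraction: "\<And>t. a (t + P) \<le> q * a t + b t"
  shows "summable a"
proof (rule summableI_nonneg_bounded)
  fix n
  have shift: "sum a {..<n + P} = sum a {..<P} + (\<Sum>t<n. a (t + P))"
    by (induction n) auto
  have "sum a {..<n} \<le> sum a {..<n + P}"
    by (rule sum_mono2) (auto simp: a_nonneg)
  also have "\<dots> \<le> sum a {..<P} + (\<Sum>t<n. q * a t + b t)"
    unfolding shift by (intro add_left_mono sum_mono contraction)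
  also have "\<dots> = sum a {..<P} + q * sum a {..<n} + sum b {..<n}"
    by (simp add: sum.distrib sum_distrib_left)
  also have "\<dots> \<le> sum a {..<P} + q * sum a {..<n} + suminf b"
    using sum_le_suminf[OF b_summable, of "{..<n}"] b_nonneg by auto
  finally have "(1 - q) * sum a {..<n} \<le> sum a {..<P} + suminf b"
    by (simp add: algebra_simps)
  then show "sum a {..<n} \<le> (sum a {..<P} + suminf b) / (1 - q)"
    using q_less_1 by (simp add: pos_le_divide_eq mult.commute)
qed (rule a_nonneg)

lemma bounded_of_delayed_contraction:
  fixes a :: "nat \<Rightarrow> real"
  assumes a_nonneg: "\<And>t. 0 \<le> a t" and b_nonneg: "0 \<le> b" and q_range: "0 \<le> q" "q < 1"
    and P_pos: "P > 0"
    and contraction: "\<And>t. a (t + P) \<le> q * a t + b"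
  shows "\<exists>M. \<forall>t. a t \<le> M"
proof -
  define M where "M = sum a {..<P} + b / (1 - q)"
  have initial: "a t \<le> M" if "t < P" for t
  proof -
    have "a t \<le> sum a {..<P}"
      by (rule member_le_sum) (use that a_nonneg in auto)
    then show ?thesis
      using b_nonneg q_range by (simp add: M_def add_increasing2)
  qed
  have invariant: "q * M + b \<le> M"
  proof -
    have "0 \<le> (1 - q) * sum a {..<P}"
      using q_range by (intro mult_nonneg_nonneg sum_nonneg a_nonneg) auto
    also have "\<dots> = (1 - q) * M - b"
      using q_range by (simp add: M_def distrib_left)
    finally show ?thesis
      by (simp add: algebra_simps)
  qed
  have "a t \<le> M" for t
  proof (induction t rule: less_induct)
    case (less t)
    show ?case
    proof (cases "t < P")
      case False
      then obtain s where shift: "t = s + P"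
        by (metis add.commute le_Suc_ex not_less)
      then have "a t \<le> q * a s + b"
        using contraction by simp
      also have "\<dots> \<le> q * M + b"
        using less.IH[of s] shift P_pos q_range by (simp add: mult_left_mono)
      finally show ?thesis
        using invariant by simp
    qed (rule initial)
  qed
  then show ?thesis
    by blast
qed

lemma sum_le_of_descent:
  fixes V w e :: "nat \<Rightarrow> real"
  assumes descent: "\<And>t. V (Suc t) \<le> V t - w t + e t"
    and e_summable: "summable e" and e_nonneg: "\<And>t. 0 \<le> e t"
  shows "V n + sum w {..<n} \<le> V 0 + suminf e"
proof -
  have "V n + sum w {..<n} \<le> V 0 + sum e {..<n}"
  proof (induction n)
    case (Suc n)
    then show ?case
      using descent[of n] by simp
  qed simp
  also have "sum e {..<n} \<le> suminf e"
    using e_summable e_nonneg by (intro sum_le_suminf) auto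
  finally show ?thesis
    by simp
qed

lemma summable_of_descent:
  fixes V w e :: "nat \<Rightarrow> real"
  assumes descent: "\<And>t. V (Suc t) \<le> V t - w t + e t"
    and e_summable: "summable e" and e_nonneg: "\<And>t. 0 \<le> e t"
    and V_lower: "\<And>t. m \<le> V t" and w_nonneg: "\<And>t. 0 \<le> w t"
  shows "summable w"
proof (rule summableI_nonneg_bounded[OF w_nonneg])
  show "sum w {..<n} \<le> V 0 + suminf e - m" for n
    using sum_le_of_descent[OF descent e_summable e_nonneg, of n] V_lower[of n] by simp
qed

lemma dist_le_of_step_bound:
  fixes x :: "nat \<Rightarrow> 'v::metric_space"
  assumes step: "\<And>t. dist (x t) (x (Suc t)) \<le> C * \<gamma> t" and C_nonneg: "0 \<le> C"
    and \<gamma>_decseq: "decseq \<gamma>"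
  shows "dist (x t) (x (t + k)) \<le> real k * (C * \<gamma> t)"
proof (induction k)
  case (Suc k)
  have "dist (x (t + k)) (x (t + Suc k)) \<le> C * \<gamma> (t + k)"
    using step[of "t + k"] by simp
  also have "\<dots> \<le> C * \<gamma> t"
    by (intro mult_left_mono decseqD[OF \<gamma>_decseq] C_nonneg) simp
  finally have "dist (x t) (x (t + Suc k)) \<le> real k * (C * \<gamma> t) + C * \<gamma> t"
    using Suc dist_triangle[of "x t" "x (t + Suc k)" "x (t + k)"] by linarith
  then show ?case
    by (simp add: algebra_simps)
qed simp

subsection \<open>Square-summable sequences\<close>

definition square_summable :: "(nat \<Rightarrow> real) \<Rightarrow> bool" where
  "square_summable a \<longleftrightarrow> summable (\<lambda>t. (a t)\<^sup>2)"

lemma square_summable_cmult: "square_summable a \<Longrightarrow> square_summable (\<lambda>t. c * a t)"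
  unfolding square_summable_def power_mult_distrib by (rule summable_mult)

lemma square_summable_sum:
  assumes "\<And>i. i \<in> I \<Longrightarrow> square_summable (a i)"
  shows "square_summable (\<lambda>t. \<Sum>i\<in>I. a i t)"
  unfolding square_summable_def
proof (rule summable_comparison_test')
  show "summable (\<lambda>t. (\<Sum>i\<in>I. (a i t)\<^sup>2) * card I)"
    using assms unfolding square_summable_def by (intro summable_mult2 summable_sum)
  show "norm ((\<Sum>i\<in>I. a i t)\<^sup>2) \<le> (\<Sum>i\<in>I. (a i t)\<^sup>2) * card I" for t
    using sum_squared_le_sum_of_squares[of "\<lambda>i. a i t" I] by simp
qed

lemma square_summable_add:
  assumes "square_summable a" "square_summable b"
  shows "square_summable (\<lambda>t. a t + b t)"
  using square_summable_sum[of UNIV "\<lambda>i. if i then a else b"] assms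
  by (simp add: UNIV_bool add.commute)

lemma square_summable_window_sum:
  assumes "square_summable a"
  shows "square_summable (\<lambda>t. \<Sum>s<P. a (t + s))"
  using assms unfolding square_summable_def
  by (intro square_summable_sum[unfolded square_summable_def] summable_ignore_initial_segment)

lemma summable_mult_of_square_summable:
  assumes "square_summable a" "square_summable b"
  shows "summable (\<lambda>t. a t * b t)"
proof (rule summable_comparison_test')
  show "summable (\<lambda>t. ((a t)\<^sup>2 + (b t)\<^sup>2) / 2)"
    using assms unfolding square_summable_def by (intro summable_divide summable_add)
  show "norm (a t * b t) \<le> ((a t)\<^sup>2 + (b t)\<^sup>2) / 2" for t
    using sum_squares_bound[of "\<bar>a t\<bar>" "\<bar>b t\<bar>"] by (simp add: abs_mult)
qed

lemma square_summable_imp_tendsto_zero: "square_summable a \<Longrightarrow> a \<longlonglongrightarrow> 0"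
  using summable_LIMSEQ_zero[of "\<lambda>t. (a t)\<^sup>2"] by (simp add: square_summable_def)

lemma square_summable_of_delayed_contraction:
  assumes a_nonneg: "\<And>t. 0 \<le> a t" and b_square_summable: "square_summable b"
    and q_range: "0 \<le> q" "q < 1"
    and contraction: "\<And>t. a (t + P) \<le> q * a t + b t"
  shows "square_summable a"
  unfolding square_summable_def
proof (rule summable_of_delayed_contraction)
  show "summable (\<lambda>t. (b t)\<^sup>2 / (1 - q))"
    using b_square_summable unfolding square_summable_def by (rule summable_divide)
  show "(a (t + P))\<^sup>2 \<le> q * (a t)\<^sup>2 + (b t)\<^sup>2 / (1 - q)" for t
  proof -
    have "q * (a t)\<^sup>2 + (b t)\<^sup>2 / (1 - q) - (q * a t + b t)\<^sup>2
        = q * ((1 - q) * a t - b t)\<^sup>2 / (1 - q)"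
      using q_range by (simp add: field_simps power2_eq_square)
    also have "\<dots> \<ge> 0"
      using q_range by simp
    finally have "(q * a t + b t)\<^sup>2 \<le> q * (a t)\<^sup>2 + (b t)\<^sup>2 / (1 - q)"
      by simp
    moreover have "(a (t + P))\<^sup>2 \<le> (q * a t + b t)\<^sup>2"
      by (intro power_mono contraction a_nonneg)
    ultimately show ?thesis
      by linarith
  qed
qed (use q_range in auto)

subsection \<open>Slowly varying sequences\<close>

lemma power2_add_le:
  fixes x y :: real
  shows "(x + y)\<^sup>2 \<le> 2 * x\<^sup>2 + 2 * y\<^sup>2"
  using zero_le_power2[of "x - y"] by (simp add: power2_sum power2_diff)

lemma abs_cube_diff_le:
  fixes x y h :: real
  assumes "0 \<le> x" "0 \<le> y" "\<bar>y - x\<bar> \<le> h"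
  shows "\<bar>y ^ 3 - x ^ 3\<bar> \<le> h * (6 * x\<^sup>2 + 6 * h\<^sup>2)"
proof -
  have "\<bar>y ^ 3 - x ^ 3\<bar> = \<bar>y - x\<bar> * \<bar>y\<^sup>2 + y * x + x\<^sup>2\<bar>"
    unfolding abs_mult[symmetric] by (simp add: power2_eq_square power3_eq_cube algebra_simps)
  also have "\<dots> \<le> h * (3 * (x + h)\<^sup>2)"
  proof (rule mult_mono)
    have "y\<^sup>2 + y * x + x\<^sup>2 \<le> (x + h)\<^sup>2 + (x + h) * (x + h) + (x + h)\<^sup>2"
      using assms by (intro add_mono power_mono mult_mono) auto
    then show "\<bar>y\<^sup>2 + y * x + x\<^sup>2\<bar> \<le> 3 * (x + h)\<^sup>2"
      using assms by (simp add: power2_eq_square)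
  qed (use assms in auto)
  also have "\<dots> \<le> h * (3 * (2 * x\<^sup>2 + 2 * h\<^sup>2))"
    using assms by (intro mult_left_mono power2_add_le) auto
  finally show ?thesis
    by (simp add: algebra_simps)
qed

lemma convergent_of_cube_convergent:
  fixes a :: "nat \<Rightarrow> real"
  assumes "convergent (\<lambda>t. a t ^ 3)"
  shows "convergent a"
proof -
  obtain c where "(\<lambda>t. a t ^ 3) \<longlonglongrightarrow> c"
    using assms by (auto simp: convergent_def)
  then have "(\<lambda>t. root 3 (a t ^ 3)) \<longlonglongrightarrow> root 3 c"
    by (rule tendsto_real_root)
  then show ?thesis
    by (auto simp: odd_real_root_power_cancel convergent_def)
qed

lemma limit_zero_of_weighted_summable:
  fixes f \<gamma> :: "nat \<Rightarrow> real"
  assumes lim: "f \<longlonglongrightarrow> c" and \<gamma>_nonneg: "\<And>t. 0 \<le> \<gamma> t" and divergent: "\<not> summable \<gamma>"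
    and f_nonneg: "\<And>t. 0 \<le> f t" and weighted: "summable (\<lambda>t. \<gamma> t * f t)"
  shows "c = 0"
proof (rule ccontr)
  assume "c \<noteq> 0"
  moreover have "0 \<le> c"
    using lim f_nonneg by (intro LIMSEQ_le_const) auto
  ultimately have c_pos: "0 < c"
    by simp
  then have "\<forall>\<^sub>F t in sequentially. c / 2 < f t"
    by (intro order_tendstoD(1)[OF lim]) auto
  then have "\<forall>\<^sub>F t in sequentially. norm (\<gamma> t) \<le> 2 / c * (\<gamma> t * f t)"
  proof (rule eventually_mono)
    fix t
    assume "c / 2 < f t"
    then have "\<gamma> t * (c / 2) \<le> \<gamma> t * f t"
      using \<gamma>_nonneg by (intro mult_left_mono) auto
    then show "norm (\<gamma> t) \<le> 2 / c * (\<gamma> t * f t)"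
      using c_pos \<gamma>_nonneg by (simp add: field_simps)
  qed
  then have "summable \<gamma>"
    by (rule summable_comparison_test_ev) (intro summable_mult weighted)
  then show False
    using divergent by simp
qed

text \<open>The increments of \<open>(a t)\<^sup>2\<close> are of order \<open>\<gamma> t * a t\<close>, which need not be summable; those of
  \<open>a t ^ 3\<close> are.\<close>

lemma tendsto_zero_of_weighted_square_summable:
  fixes a \<gamma> :: "nat \<Rightarrow> real"
  assumes a_nonneg: "\<And>t. 0 \<le> a t" and \<gamma>_nonneg: "\<And>t. 0 \<le> \<gamma> t" and \<gamma>_le_1: "\<And>t. \<gamma> t \<le> 1"
    and divergent: "\<not> summable \<gamma>" and \<gamma>_square_summable: "square_summable \<gamma>"
    and weighted: "summable (\<lambda>t. \<gamma> t * (a t)\<^sup>2)"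
    and step: "\<And>t. dist (a t) (a (Suc t)) \<le> C * \<gamma> t" and C_nonneg: "0 \<le> C"
  shows "a \<longlonglongrightarrow> 0"
proof -
  have "summable (\<lambda>t. a (Suc t) ^ 3 - a t ^ 3)"
  proof (rule summable_comparison_test')
    show "summable (\<lambda>t. C * (6 * (\<gamma> t * (a t)\<^sup>2)) + C * (6 * C\<^sup>2 * (\<gamma> t)\<^sup>2))"
      using \<gamma>_square_summable unfolding square_summable_def
      by (intro summable_add summable_mult weighted)
    fix t
    have "\<bar>a (Suc t) ^ 3 - a t ^ 3\<bar> \<le> C * \<gamma> t * (6 * (a t)\<^sup>2 + 6 * (C * \<gamma> t)\<^sup>2)"
      using step[of t]
      by (intro abs_cube_diff_le a_nonneg) (simp add: dist_real_def abs_minus_commute)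
    also have "\<dots> = C * (6 * (\<gamma> t * (a t)\<^sup>2)) + C * (6 * C\<^sup>2 * (\<gamma> t)\<^sup>2) * \<gamma> t"
      by (simp add: power2_eq_square algebra_simps)
    also have "C * (6 * C\<^sup>2 * (\<gamma> t)\<^sup>2) * \<gamma> t \<le> C * (6 * C\<^sup>2 * (\<gamma> t)\<^sup>2)"
      using \<gamma>_nonneg[of t] \<gamma>_le_1[of t] C_nonneg by (simp add: mult_left_le)
    finally show "norm (a (Suc t) ^ 3 - a t ^ 3)
        \<le> C * (6 * (\<gamma> t * (a t)\<^sup>2)) + C * (6 * C\<^sup>2 * (\<gamma> t)\<^sup>2)"
      by simp
  qed
  then have "convergent (\<lambda>t. a t ^ 3)"
    unfolding summable_iff_convergent sum_lessThan_telescope[of "\<lambda>t. a t ^ 3"]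
    by (simp only: convergent_diff_const_right_iff)
  then obtain c where lim: "a \<longlonglongrightarrow> c"
    using convergent_of_cube_convergent by (auto simp: convergent_def)
  then have "(\<lambda>t. (a t)\<^sup>2) \<longlonglongrightarrow> c\<^sup>2"
    by (rule tendsto_power)
  then have "c\<^sup>2 = 0"
    by (rule limit_zero_of_weighted_summable[OF _ \<gamma>_nonneg divergent _ weighted]) simp
  then show ?thesis
    using lim by simp
qed

lemma weighted_square_summable_of_windowed:
  fixes a \<gamma> :: "nat \<Rightarrow> real"
  assumes a_nonneg: "\<And>t. 0 \<le> a t" and \<gamma>_nonneg: "\<And>t. 0 \<le> \<gamma> t" and \<gamma>_le_1: "\<And>t. \<gamma> t \<le> 1"
    and \<gamma>_decseq: "decseq \<gamma>" and \<gamma>_square_summable: "square_summable \<gamma>"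
    and step: "\<And>t. dist (a t) (a (Suc t)) \<le> C * \<gamma> t" and C_nonneg: "0 \<le> C"
    and window: "\<And>t. \<exists>s<T. t + s \<in> S"
    and selected: "summable (\<lambda>t. if t \<in> S then \<gamma> t * (a t)\<^sup>2 else 0)"
  shows "summable (\<lambda>t. \<gamma> t * (a t)\<^sup>2)"
proof -
  define b where "b t = (if t \<in> S then \<gamma> t * (a t)\<^sup>2 else 0)" for t
  have "summable (\<lambda>t. \<gamma> (t + T) * (a (t + T))\<^sup>2)"
  proof (rule summable_comparison_test')
    show "summable (\<lambda>t. 2 * (\<Sum>s<T. b (t + s)) + 2 * (T * C)\<^sup>2 * (\<gamma> t)\<^sup>2)"
      using selected[folded b_def] \<gamma>_square_summable unfolding square_summable_def
      by (intro summable_add summable_mult summable_sum summable_ignore_initial_segment)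
    fix t
    obtain s where hit: "s < T" "t + s \<in> S"
      using window by blast
    have "dist (a (t + s)) (a (t + s + (T - s))) \<le> real (T - s) * (C * \<gamma> (t + s))"
      by (rule dist_le_of_step_bound[OF step C_nonneg \<gamma>_decseq])
    also have "\<dots> \<le> T * (C * \<gamma> t)"
      using C_nonneg \<gamma>_nonneg decseqD[OF \<gamma>_decseq, of t "t + s"]
      by (intro mult_mono mult_left_mono) auto
    finally have "a (t + T) \<le> a (t + s) + T * (C * \<gamma> t)"
      using hit by (simp add: dist_real_def)
    then have "(a (t + T))\<^sup>2 \<le> (a (t + s) + T * (C * \<gamma> t))\<^sup>2"
      by (intro power_mono a_nonneg)
    also have "\<dots> \<le> 2 * (a (t + s))\<^sup>2 + 2 * (T * (C * \<gamma> t))\<^sup>2"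
      by (rule power2_add_le)
    finally have "\<gamma> (t + T) * (a (t + T))\<^sup>2
        \<le> \<gamma> (t + T) * (2 * (a (t + s))\<^sup>2) + \<gamma> (t + T) * (2 * (T * (C * \<gamma> t))\<^sup>2)"
      unfolding distrib_left[symmetric] by (rule mult_left_mono[OF _ \<gamma>_nonneg])
    also have "\<dots> \<le> \<gamma> (t + s) * (2 * (a (t + s))\<^sup>2) + 1 * (2 * (T * (C * \<gamma> t))\<^sup>2)"
      by (intro add_mono mult_right_mono decseqD[OF \<gamma>_decseq] \<gamma>_le_1) (use hit in auto)
    also have "\<dots> = 2 * b (t + s) + 2 * (T * C)\<^sup>2 * (\<gamma> t)\<^sup>2"
      using hit by (simp add: b_def power_mult_distrib)
    also have "b (t + s) \<le> (\<Sum>s<T. b (t + s))"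
      by (rule member_le_sum[of s "{..<T}" "\<lambda>s. b (t + s)"])
        (use hit \<gamma>_nonneg in \<open>auto simp: b_def\<close>)
    finally show "norm (\<gamma> (t + T) * (a (t + T))\<^sup>2)
        \<le> 2 * (\<Sum>s<T. b (t + s)) + 2 * (T * C)\<^sup>2 * (\<gamma> t)\<^sup>2"
      using \<gamma>_nonneg by simp
  qed
  then show ?thesis
    by (subst (asm) summable_iff_shift)
qed

section \<open>Averaging over a network\<close>

abbreviation spread :: "('a::finite \<Rightarrow> 'v::real_normed_vector) \<Rightarrow> real" where
  "spread u \<equiv> diameter (range u)"

lemma norm_diff_le_spread: "norm (u i - u j) \<le> spread u"
  unfolding dist_norm[symmetric] by (rule diameter_bounded_bound) (auto intro: finite_imp_bounded)

lemma spread_nonneg [simp]: "0 \<le> spread u"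
  by (intro diameter_ge_0 finite_imp_bounded) simp

lemma norm_convex_combination_diff_le:
  fixes u :: "'a::finite \<Rightarrow> 'v::real_normed_vector"
  assumes p_nonneg: "\<And>j. 0 \<le> p j" and p_sum: "sum p UNIV = 1"
    and near: "\<And>j. norm (u j - x) \<le> d"
  shows "norm ((\<Sum>j\<in>UNIV. p j *\<^sub>R u j) - x) \<le> d"
proof -
  have "(\<Sum>j\<in>UNIV. p j *\<^sub>R u j) \<in> cball x d"
    by (intro convex_sum convex_cball p_nonneg p_sum)
      (use near in \<open>auto simp: dist_norm norm_minus_commute\<close>)
  then show ?thesis
    by (simp add: dist_norm norm_minus_commute)
qed

lemma norm_weighted_sum_diff_le:
  fixes u :: "'a::finite \<Rightarrow> 'v::real_normed_vector"
  assumes p_nonneg: "\<And>j. 0 \<le> p j" and p_sum: "sum p UNIV = s"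
    and q_nonneg: "\<And>j. 0 \<le> q j" and q_sum: "sum q UNIV = s"
    and distances: "\<And>j k. norm (u j - u k) \<le> d"
  shows "norm ((\<Sum>j\<in>UNIV. p j *\<^sub>R u j) - (\<Sum>k\<in>UNIV. q k *\<^sub>R u k)) \<le> s * d"
proof (cases "s = 0")
  case True
  then have "p j = 0" "q j = 0" for j
    using p_nonneg p_sum q_nonneg q_sum by (simp_all add: sum_nonneg_eq_0_iff)
  then show ?thesis
    using True by simp
next
  case False
  then have s_pos: "0 < s"
    using sum_nonneg[of UNIV p] p_nonneg p_sum by fastforce
  let ?D = "(\<Sum>j\<in>UNIV. p j *\<^sub>R u j) - (\<Sum>k\<in>UNIV. q k *\<^sub>R u k)"
  have "s *\<^sub>R (\<Sum>j\<in>UNIV. p j *\<^sub>R u j) = (\<Sum>j\<in>UNIV. \<Sum>k\<in>UNIV. (p j * q k) *\<^sub>R u j)"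
    by (simp add: scaleR_sum_right mult.commute q_sum flip: scaleR_left.sum sum_distrib_left)
  moreover have "s *\<^sub>R (\<Sum>k\<in>UNIV. q k *\<^sub>R u k) = (\<Sum>j\<in>UNIV. \<Sum>k\<in>UNIV. (p j * q k) *\<^sub>R u k)"
    by (subst sum.swap)
      (simp add: scaleR_sum_right p_sum flip: scaleR_left.sum sum_distrib_right)
  ultimately have "s *\<^sub>R ?D = (\<Sum>j\<in>UNIV. \<Sum>k\<in>UNIV. (p j * q k) *\<^sub>R (u j - u k))"
    by (simp add: scaleR_diff_right sum_subtractf)
  also have "norm \<dots> \<le> (\<Sum>j\<in>UNIV. \<Sum>k\<in>UNIV. p j * q k * d)"
    using p_nonneg q_nonneg by (intro sum_norm_le) (auto intro!: mult_left_mono distances)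
  also have "\<dots> = s * (s * d)"
    by (simp add: p_sum q_sum mult.assoc flip: sum_distrib_left sum_distrib_right)
  finally show ?thesis
    using s_pos by simp
qed

text \<open>Doeblin's condition: the rows of \<open>Q\<close> share the mass \<open>\<delta>\<close> in column \<open>m\<close>, which cancels in
  every difference of two rows.\<close>

lemma spread_contraction:
  fixes u :: "'a::finite \<Rightarrow> 'v::real_normed_vector"
  assumes Q_nonneg: "\<And>i j. 0 \<le> Q i j" and Q_row_sum: "\<And>i. sum (Q i) UNIV = 1"
    and common_mass: "\<And>i. \<delta> \<le> Q i m"
  shows "spread (\<lambda>i. \<Sum>j\<in>UNIV. Q i j *\<^sub>R u j) \<le> (1 - \<delta>) * spread u"
proof (rule diameter_le)
  define R where "R i j = Q i j - (if j = m then \<delta> else 0)" for i j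
  have R_nonneg: "0 \<le> R i j" and R_row_sum: "sum (R i) UNIV = 1 - \<delta>" for i j
    using Q_nonneg Q_row_sum common_mass by (simp_all add: R_def sum_subtractf)
  have split: "(\<Sum>j\<in>UNIV. Q i j *\<^sub>R u j) = (\<Sum>j\<in>UNIV. R i j *\<^sub>R u j) + \<delta> *\<^sub>R u m" for i
    by (simp add: R_def scaleR_diff_left sum_subtractf if_distrib[of "\<lambda>x. x *\<^sub>R _"] cong: if_cong)
  have "norm ((\<Sum>j\<in>UNIV. Q i j *\<^sub>R u j) - (\<Sum>j\<in>UNIV. Q k j *\<^sub>R u j)) \<le> (1 - \<delta>) * spread u" for i k
    unfolding split add_diff_cancel_right
    by (intro norm_weighted_sum_diff_le R_nonneg R_row_sum norm_diff_le_spread)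
  then show "norm (x - y) \<le> (1 - \<delta>) * spread u"
    if "x \<in> range (\<lambda>i. \<Sum>j\<in>UNIV. Q i j *\<^sub>R u j)" "y \<in> range (\<lambda>i. \<Sum>j\<in>UNIV. Q i j *\<^sub>R u j)" for x y
    using that by auto
qed simp

subsection \<open>Products of mixing matrices\<close>

locale persistent_mixing =
  fixes W :: "nat \<Rightarrow> 'a::finite \<Rightarrow> 'a \<Rightarrow> real" and E :: "('a \<times> 'a) set" and \<eta> :: real and T :: nat
  assumes nonneg: "0 \<le> W t i j"
    and \<eta>_pos: "0 < \<eta>"
    and loop: "\<eta> \<le> W t i i"
    and window: "(j, i) \<in> E \<Longrightarrow> \<exists>s<T. \<eta> \<le> W (t + s) i j"
    and strongly_connected: "(i, j) \<in> E\<^sup>*"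
begin

primrec transition :: "nat \<Rightarrow> nat \<Rightarrow> 'a \<Rightarrow> 'a \<Rightarrow> real" where
  "transition t 0 i j = (if j = i then 1 else 0)"
| "transition t (Suc p) i j = (\<Sum>k\<in>UNIV. W (t + p) i k * transition t p k j)"

lemma transition_0_apply:
  fixes u :: "'a \<Rightarrow> 'v::real_vector"
  shows "(\<Sum>j\<in>UNIV. transition t 0 i j *\<^sub>R u j) = u i"
  by (simp add: if_distrib[of "\<lambda>x. x *\<^sub>R _"] cong: if_cong)

lemma transition_Suc_apply:
  fixes u :: "'a \<Rightarrow> 'v::real_vector"
  shows "(\<Sum>j\<in>UNIV. transition t (Suc p) i j *\<^sub>R u j)
    = (\<Sum>k\<in>UNIV. W (t + p) i k *\<^sub>R (\<Sum>j\<in>UNIV. transition t p k j *\<^sub>R u j))"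
proof -
  have "(\<Sum>j\<in>UNIV. transition t (Suc p) i j *\<^sub>R u j)
      = (\<Sum>j\<in>UNIV. \<Sum>k\<in>UNIV. W (t + p) i k *\<^sub>R transition t p k j *\<^sub>R u j)"
    by (simp add: scaleR_left.sum)
  then show ?thesis
    by (subst (asm) sum.swap) (simp add: scaleR_sum_right)
qed

lemma transition_nonneg: "0 \<le> transition t p i j"
  by (induction p arbitrary: i) (auto intro!: sum_nonneg mult_nonneg_nonneg nonneg)

lemma transition_Suc_ge: "W (t + p) i k * transition t p k j \<le> transition t (Suc p) i j"
  unfolding transition.simps(2)
  by (rule member_le_sum) (auto intro: mult_nonneg_nonneg nonneg transition_nonneg)

lemma transition_ge_power_mono:
  assumes initial: "\<eta> ^ m \<le> transition t m i j" and "m \<le> p"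
  shows "\<eta> ^ p \<le> transition t p i j"
  using \<open>m \<le> p\<close>
proof (induction p rule: dec_induct)
  case (step p)
  have "\<eta> * \<eta> ^ p \<le> W (t + p) i i * transition t p i j"
    using \<eta>_pos by (intro mult_mono loop step.IH nonneg) auto
  also have "\<dots> \<le> transition t (Suc p) i j"
    by (rule transition_Suc_ge)
  finally show ?case
    by simp
qed (rule initial)

lemma transition_eventually_ge_power:
  assumes "(j, i) \<in> E\<^sup>*"
  shows "\<exists>p0. \<forall>t. \<forall>p\<ge>p0. \<eta> ^ p \<le> transition t p i j"
  using assms
proof (induction rule: rtrancl_induct)
  case base
  have "\<eta> ^ p \<le> transition t p j j" for t p
    by (rule transition_ge_power_mono[of 0]) auto
  then show ?case
    by blast
next
  case (step k i)
  then obtain p0 where positive: "\<And>t p. p \<ge> p0 \<Longrightarrow> \<eta> ^ p \<le> transition t p k j"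
    by blast
  show ?case
  proof (intro exI[of _ "p0 + T"] allI impI)
    fix t p
    assume late: "p0 + T \<le> p"
    obtain s where active: "s < T" "\<eta> \<le> W (t + p0 + s) i k"
      using window[OF step(2), of "t + p0"] by blast
    have "\<eta> * \<eta> ^ (p0 + s) \<le> W (t + (p0 + s)) i k * transition t (p0 + s) k j"
      using active \<eta>_pos by (intro mult_mono positive nonneg) (auto simp: add.assoc)
    also have "\<dots> \<le> transition t (Suc (p0 + s)) i j"
      by (rule transition_Suc_ge)
    finally have "\<eta> ^ Suc (p0 + s) \<le> transition t (Suc (p0 + s)) i j"
      by simp
    then show "\<eta> ^ p \<le> transition t p i j"
      by (rule transition_ge_power_mono) (use active late in auto)
  qed
qed

lemma transition_uniformly_positive: "\<exists>P>0. \<forall>t i j. \<eta> ^ P \<le> transition t P i j"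
proof -
  obtain p0 where positive: "\<And>i j t p. p \<ge> p0 i j \<Longrightarrow> \<eta> ^ p \<le> transition t p i j"
    using transition_eventually_ge_power[OF strongly_connected] by metis
  define P where "P = Suc (Max (range (case_prod p0)))"
  have "p0 i j \<le> P" for i j
    unfolding P_def by (intro le_SucI Max_ge) (auto intro!: rev_image_eqI[of "(i, j)"])
  moreover have "P > 0"
    by (simp add: P_def)
  ultimately show ?thesis
    using positive by blast
qed

end

subsection \<open>Perturbed consensus\<close>

locale averaging = persistent_mixing +
  assumes row_sum: "sum (W t i) UNIV = 1"
begin

lemma transition_row_sum: "sum (transition t p i) UNIV = 1"
proof (induction p arbitrary: i)
  case (Suc p)
  then show ?case
    using transition_Suc_apply[of t p i "\<lambda>_. 1 :: real"]
    by (simp add: row_sum del: transition.simps(2))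
qed simp

context
  fixes u \<epsilon> :: "nat \<Rightarrow> 'a \<Rightarrow> 'v::real_normed_vector" and e :: "nat \<Rightarrow> real"
  assumes step: "\<And>t i. u (Suc t) i = (\<Sum>j\<in>UNIV. W t i j *\<^sub>R (u t j + \<epsilon> t j))"
    and perturbation: "\<And>t j. norm (\<epsilon> t j) \<le> e t"
begin

lemma norm_accumulated_perturbation_le:
  "norm (u (t + p) i - (\<Sum>j\<in>UNIV. transition t p i j *\<^sub>R u t j)) \<le> (\<Sum>s<p. e (t + s))"
proof (induction p arbitrary: i)
  case 0
  then show ?case
    unfolding transition_0_apply by simp
next
  case (Suc p)
  let ?v = "\<lambda>i. \<Sum>j\<in>UNIV. transition t p i j *\<^sub>R u t j"
  have "u (t + Suc p) i - (\<Sum>j\<in>UNIV. transition t (Suc p) i j *\<^sub>R u t j)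
      = (\<Sum>j\<in>UNIV. W (t + p) i j *\<^sub>R (u (t + p) j - ?v j + \<epsilon> (t + p) j)) - 0"
    unfolding transition_Suc_apply
    by (simp add: step scaleR_add_right scaleR_diff_right sum_subtractf sum.distrib)
  also have "norm \<dots> \<le> (\<Sum>s<p. e (t + s)) + e (t + p)"
  proof (intro norm_convex_combination_diff_le nonneg row_sum)
    show "norm (u (t + p) j - ?v j + \<epsilon> (t + p) j - 0) \<le> (\<Sum>s<p. e (t + s)) + e (t + p)" for j
      unfolding diff_zero by (intro norm_triangle_mono Suc perturbation)
  qed
  finally show ?case
    by simp
qed

lemma spread_delayed_contraction:
  assumes common_mass: "\<And>i. \<delta> \<le> transition t P i m"
  shows "spread (u (t + P)) \<le> (1 - \<delta>) * spread (u t) + 2 * (\<Sum>s<P. e (t + s))"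
proof (rule diameter_le)
  let ?v = "\<lambda>i. \<Sum>j\<in>UNIV. transition t P i j *\<^sub>R u t j" and ?e = "\<Sum>s<P. e (t + s)"
  have "norm (u (t + P) i - u (t + P) k) \<le> (1 - \<delta>) * spread (u t) + 2 * ?e" for i k
  proof -
    have "norm (?v i - ?v k) \<le> spread ?v"
      by (rule norm_diff_le_spread)
    also have "\<dots> \<le> (1 - \<delta>) * spread (u t)"
      by (intro spread_contraction[where m = m] transition_nonneg transition_row_sum common_mass)
    finally have transported: "norm (?v i - ?v k) \<le> (1 - \<delta>) * spread (u t)" .
    have accumulated: "norm ((u (t + P) i - ?v i) - (u (t + P) k - ?v k)) \<le> ?e + ?e"
      by (rule norm_triangle_le_diff[OF add_mono]) (rule norm_accumulated_perturbation_le)+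
    show ?thesis
      using norm_triangle_mono[OF transported accumulated] by (simp add: algebra_simps)
  qed
  then show "norm (x - y) \<le> (1 - \<delta>) * spread (u t) + 2 * ?e"
    if "x \<in> range (u (t + P))" "y \<in> range (u (t + P))" for x y
    using that by auto
qed simp

lemma uniform_spread_contraction:
  "\<exists>P>0. \<exists>q\<ge>0. q < 1 \<and>
    (\<forall>t. spread (u (t + P)) \<le> q * spread (u t) + 2 * (\<Sum>s<P. e (t + s)))"
proof -
  obtain P where P_pos: "P > 0" and positive: "\<And>t i j. \<eta> ^ P \<le> transition t P i j"
    using transition_uniformly_positive by blast
  have "transition t P i j \<le> sum (transition t P i) UNIV" for t i j
    by (rule member_le_sum) (auto intro: transition_nonneg)
  then have "\<eta> ^ P \<le> 1"
    using positive order_trans unfolding transition_row_sum by blast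
  then show ?thesis
    using P_pos \<eta>_pos
    by (intro exI[of _ P] exI[of _ "1 - \<eta> ^ P"] conjI allI spread_delayed_contraction positive) auto
qed

lemma spread_bounded:
  assumes "\<And>t. e t \<le> c"
  shows "\<exists>M. \<forall>t. spread (u t) \<le> M"
proof -
  obtain P q where P_pos: "P > 0" and q_range: "0 \<le> q" "q < 1"
      and contraction: "\<And>t. spread (u (t + P)) \<le> q * spread (u t) + 2 * (\<Sum>s<P. e (t + s))"
    using uniform_spread_contraction by blast
  have window_sum: "(\<Sum>s<P. e (t + s)) \<le> P * c" for t
    using sum_bounded_above[of "{..<P}" "\<lambda>s. e (t + s)" c] assms by simp
  show ?thesis
  proof (rule bounded_of_delayed_contraction[OF _ _ q_range P_pos])
    have "0 \<le> e 0"
      using perturbation norm_ge_zero order_trans by blast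
    then show "0 \<le> 2 * (P * c)"
      using assms[of 0] by simp
    show "spread (u (t + P)) \<le> q * spread (u t) + 2 * (P * c)" for t
      using contraction[of t] window_sum[of t] by simp
  qed simp
qed

lemma spread_square_summable:
  assumes "square_summable e"
  shows "square_summable (\<lambda>t. spread (u t))"
proof -
  obtain P q where q_range: "0 \<le> q" "q < 1"
      and contraction: "\<And>t. spread (u (t + P)) \<le> q * spread (u t) + 2 * (\<Sum>s<P. e (t + s))"
    using uniform_spread_contraction by blast
  show ?thesis
  proof (rule square_summable_of_delayed_contraction)
    show "square_summable (\<lambda>t. 2 * (\<Sum>s<P. e (t + s)))"
      by (intro square_summable_cmult square_summable_window_sum assms)
  qed (use q_range contraction in auto)
qed

end

end

subsection \<open>Push-sum\<close>

locale push_sum = persistent_mixing A E \<kappa> T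
  for A :: "nat \<Rightarrow> 'a::finite \<Rightarrow> 'a \<Rightarrow> real" and E \<kappa> T +
  fixes \<phi> :: "nat \<Rightarrow> 'a \<Rightarrow> real"
  assumes column_sum: "(\<Sum>i\<in>UNIV. A t i j) = 1"
    and \<phi>_0: "\<phi> 0 i = 1"
    and \<phi>_Suc: "\<phi> (Suc t) i = (\<Sum>j\<in>UNIV. A t i j * \<phi> t j)"
begin

lemma \<kappa>_le_1: "\<kappa> \<le> 1"
proof -
  have "\<kappa> \<le> A t i i" for t i
    by (rule loop)
  also have "A t i i \<le> (\<Sum>k\<in>UNIV. A t k i)" for t i
    by (rule member_le_sum) (auto intro: nonneg)
  finally show ?thesis
    by (simp add: column_sum)
qed

lemma \<phi>_transition: "\<phi> (t + p) i = (\<Sum>j\<in>UNIV. transition t p i j *\<^sub>R \<phi> t j)"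
proof (induction p arbitrary: i)
  case 0
  then show ?case
    unfolding transition_0_apply by simp
next
  case (Suc p)
  then show ?case
    unfolding transition_Suc_apply by (simp add: \<phi>_Suc)
qed

lemma \<phi>_ge_power: "\<kappa> ^ t \<le> \<phi> t i"
proof -
  have "\<kappa> ^ t \<le> transition 0 t i i"
    by (rule transition_ge_power_mono[of 0]) auto
  also have "\<dots> \<le> (\<Sum>j\<in>UNIV. transition 0 t i j)"
    by (rule member_le_sum) (auto intro: transition_nonneg)
  finally show ?thesis
    using \<phi>_transition[of 0 t i] by (simp add: \<phi>_0)
qed

lemma \<phi>_pos: "0 < \<phi> t i"
  using \<phi>_ge_power \<eta>_pos by (meson less_le_trans zero_less_power)

lemma \<phi>_sum: "sum (\<phi> t) UNIV = real CARD('a)"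
proof (induction t)
  case (Suc t)
  have "sum (\<phi> (Suc t)) UNIV = (\<Sum>j\<in>UNIV. \<Sum>i\<in>UNIV. A t i j * \<phi> t j)"
    unfolding \<phi>_Suc by (rule sum.swap)
  then show ?case
    using Suc by (simp add: column_sum flip: sum_distrib_right)
qed (simp add: \<phi>_0)

lemma \<phi>_le_card: "\<phi> t i \<le> real CARD('a)"
  unfolding \<phi>_sum[of t, symmetric] by (rule member_le_sum) (auto intro: less_imp_le \<phi>_pos)

lemma \<phi>_uniformly_positive: "\<exists>c>0. \<forall>t i. c \<le> \<phi> t i"
proof -
  obtain P where positive: "\<And>t i j. \<kappa> ^ P \<le> transition t P i j"
    using transition_uniformly_positive by blast
  have "\<kappa> ^ P \<le> \<phi> t i" for t i
  proof (cases "t < P")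
    case True
    then have "\<kappa> ^ P \<le> \<kappa> ^ t"
      using \<eta>_pos \<kappa>_le_1 by (intro power_decreasing) auto
    then show ?thesis
      using \<phi>_ge_power order_trans by blast
  next
    case False
    then obtain s where shift: "t = s + P"
      by (metis add.commute le_Suc_ex not_less)
    have "\<kappa> ^ P * 1 \<le> \<kappa> ^ P * real CARD('a)"
      using \<eta>_pos by (intro mult_left_mono) (auto simp: Suc_le_eq)
    also have "\<dots> = (\<Sum>j\<in>UNIV. \<kappa> ^ P * \<phi> s j)"
      by (simp add: \<phi>_sum flip: sum_distrib_left)
    also have "\<dots> \<le> \<phi> t i"
      unfolding shift \<phi>_transition real_scaleR_def
      by (intro sum_mono mult_right_mono positive) (simp add: \<phi>_pos less_imp_le)
    finally show ?thesis
      by simp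
  qed
  then show ?thesis
    using \<eta>_pos by (intro exI[of _ "\<kappa> ^ P"]) auto
qed

definition \<phi>_min :: real where
  "\<phi>_min = (INF (t, i). \<phi> t i)"

lemma \<phi>_min_pos: "0 < \<phi>_min"
proof -
  obtain c where "c > 0" "\<And>t i. c \<le> \<phi> t i"
    using \<phi>_uniformly_positive by blast
  then show ?thesis
    unfolding \<phi>_min_def by (intro less_le_trans[OF _ cINF_greatest]) auto
qed

lemma \<phi>_min_le: "\<phi>_min \<le> \<phi> t i"
proof -
  have "bdd_below (range (\<lambda>(t, i). \<phi> t i))"
    by (rule bdd_belowI2[of _ 0]) (auto intro: less_imp_le \<phi>_pos)
  from cINF_lower[OF this UNIV_I, of "(t, i)"] show ?thesis
    by (simp add: \<phi>_min_def)
qed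

lemma norm_inverse_\<phi>_scaleR_le:
  fixes v :: "'v::real_normed_vector"
  assumes "norm v \<le> d"
  shows "norm ((1 / \<phi> t i) *\<^sub>R v) \<le> d / \<phi>_min"
proof -
  have "norm v / \<phi> t i \<le> d / \<phi>_min"
    using assms order_trans[OF norm_ge_zero assms]
    by (intro frac_le \<phi>_min_le \<phi>_min_pos) auto
  then show ?thesis
    using \<phi>_pos[of t i] by simp
qed

definition weight :: "nat \<Rightarrow> 'a \<Rightarrow> 'a \<Rightarrow> real" where
  "weight t i j = A t i j * \<phi> t j / \<phi> (Suc t) i"

lemma weight_nonneg: "0 \<le> weight t i j"
  unfolding weight_def
  by (intro divide_nonneg_nonneg mult_nonneg_nonneg nonneg less_imp_le[OF \<phi>_pos])

lemma weight_sum: "sum (weight t i) UNIV = 1"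
  using \<phi>_pos[of "Suc t" i] by (simp add: weight_def flip: sum_divide_distrib \<phi>_Suc)

lemma weight_ge:
  assumes "\<kappa> \<le> A t i j"
  shows "\<kappa> * \<phi>_min / real CARD('a) \<le> weight t i j"
  unfolding weight_def using assms \<eta>_pos \<phi>_min_pos
  by (intro frac_le mult_mono mult_nonneg_nonneg nonneg \<phi>_min_le \<phi>_le_card
      \<phi>_pos less_imp_le[OF \<phi>_pos]) auto

sublocale weights: averaging weight E "\<kappa> * \<phi>_min / real CARD('a)" T
proof
  show "\<exists>s<T. \<kappa> * \<phi>_min / real CARD('a) \<le> weight (t + s) i j" if "(j, i) \<in> E" for t i j
    using window[OF that] weight_ge by blast
qed (auto intro: weight_nonneg weight_sum weight_ge loop strongly_connected
    simp: \<eta>_pos \<phi>_min_pos)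

definition mean :: "nat \<Rightarrow> ('a \<Rightarrow> 'v::real_vector) \<Rightarrow> 'v" where
  "mean t u = (\<Sum>j\<in>UNIV. (\<phi> t j / real CARD('a)) *\<^sub>R u j)"

lemma mean_weight_nonneg: "0 \<le> \<phi> t j / real CARD('a)"
  by (simp add: \<phi>_pos less_imp_le)

lemma mean_weight_sum: "(\<Sum>j\<in>UNIV. \<phi> t j / real CARD('a)) = 1"
  by (simp add: \<phi>_sum flip: sum_divide_distrib)

lemma mean_mix: "mean (Suc t) (\<lambda>i. \<Sum>j\<in>UNIV. weight t i j *\<^sub>R u j) = mean t u"
proof -
  have "\<phi> (Suc t) i * weight t i j = A t i j * \<phi> t j" for i j
    using \<phi>_pos[of "Suc t" i] by (simp add: weight_def)
  then have "mean (Suc t) (\<lambda>i. \<Sum>j\<in>UNIV. weight t i j *\<^sub>R u j)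
      = (\<Sum>i\<in>UNIV. \<Sum>j\<in>UNIV. (A t i j * \<phi> t j / real CARD('a)) *\<^sub>R u j)"
    by (simp add: mean_def scaleR_sum_right)
  also have "\<dots> = (\<Sum>j\<in>UNIV. \<Sum>i\<in>UNIV. (A t i j * \<phi> t j / real CARD('a)) *\<^sub>R u j)"
    by (rule sum.swap)
  also have "\<dots> = mean t u"
    by (simp add: mean_def column_sum flip: scaleR_left.sum sum_distrib_right sum_divide_distrib)
  finally show ?thesis .
qed

lemma mean_add: "mean t (\<lambda>j. u j + v j) = mean t u + mean t v"
  by (simp add: mean_def scaleR_add_right sum.distrib)

lemma mean_scaleR: "mean t (\<lambda>j. c *\<^sub>R u j) = c *\<^sub>R mean t u"
  by (simp add: mean_def scaleR_sum_right mult.commute)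

lemma mean_cmult: "mean t (\<lambda>j. c * u j) = c * mean t u" for u :: "'a \<Rightarrow> real"
  using mean_scaleR[of t c u] by simp

lemma mean_diff: "mean t (\<lambda>j. u j - v j) = mean t u - mean t v"
  by (simp add: mean_def scaleR_diff_right sum_subtractf)

lemma mean_const: "mean t (\<lambda>j. c) = c"
  by (simp add: mean_def mean_weight_sum flip: scaleR_left.sum)

lemma inner_mean: "inner p (mean t u) = mean t (\<lambda>j. inner p (u j))"
  by (simp add: mean_def inner_sum_right)

lemma mean_mono:
  fixes u v :: "'a \<Rightarrow> real"
  assumes "\<And>j. u j \<le> v j"
  shows "mean t u \<le> mean t v"
  unfolding mean_def by (intro sum_mono scaleR_left_mono assms mean_weight_nonneg)

lemma mean_nonneg: "(\<And>j. 0 \<le> u j) \<Longrightarrow> 0 \<le> mean t u" for u :: "'a \<Rightarrow> real"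
  using mean_mono[of "\<lambda>_. 0" u t] by (simp add: mean_const)

lemma le_mean:
  fixes u :: "'a \<Rightarrow> real"
  assumes "\<And>j. 0 \<le> u j"
  shows "\<phi>_min / real CARD('a) * u i \<le> mean t u"
proof -
  have "\<phi>_min / real CARD('a) * u i \<le> \<phi> t i / real CARD('a) * u i"
    by (intro mult_right_mono divide_right_mono \<phi>_min_le assms) simp
  also have "\<dots> \<le> mean t u"
    unfolding mean_def real_scaleR_def
    by (rule member_le_sum)
      (auto simp del: times_divide_eq_left intro: mult_nonneg_nonneg mean_weight_nonneg assms)
  finally show ?thesis .
qed

lemma mean_in_convex: "convex S \<Longrightarrow> (\<And>j. u j \<in> S) \<Longrightarrow> mean t u \<in> S"
  unfolding mean_def by (intro convex_sum mean_weight_nonneg mean_weight_sum) auto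

lemma convex_on_mean_le:
  assumes "convex_on S h" "\<And>j. u j \<in> S"
  shows "h (mean t u) \<le> mean t (\<lambda>j. h (u j))"
  unfolding mean_def real_scaleR_def
  by (rule convex_on_sum[OF _ _ assms(1) mean_weight_sum mean_weight_nonneg]) (use assms(2) in auto)

lemma norm_mean_diff_le: "(\<And>j. norm (u j - x) \<le> d) \<Longrightarrow> norm (mean t u - x) \<le> d"
  unfolding mean_def by (intro norm_convex_combination_diff_le mean_weight_nonneg mean_weight_sum)

lemma norm_diff_mean_le_spread: "norm (u i - mean t u) \<le> spread u"
  using norm_mean_diff_le[of u "u i" "spread u" t]
  by (simp add: norm_diff_le_spread norm_minus_commute)

end

section \<open>Convex optimization\<close>

subsection \<open>Directional derivatives\<close>

lemma GDERIV_directional: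
  fixes h :: "'v::real_inner \<Rightarrow> real"
  assumes "GDERIV h (x + s *\<^sub>R v) :> p"
  shows "((\<lambda>s. h (x + s *\<^sub>R v)) has_real_derivative inner p v) (at s)"
proof -
  have "((\<lambda>s. x + s *\<^sub>R v) has_derivative (\<lambda>k. k *\<^sub>R v)) (at s)"
    by (auto intro!: derivative_eq_intros)
  moreover have "(h has_derivative (\<lambda>k. inner k p)) (at (x + s *\<^sub>R v))"
    using assms by (simp add: gderiv_def)
  ultimately have "((\<lambda>s. h (x + s *\<^sub>R v)) has_derivative (\<lambda>k. inner (k *\<^sub>R v) p)) (at s)"
    using has_derivative_compose by blast
  then show ?thesis
    by (simp add: has_field_derivative_def inner_commute mult_commute_abs)
qed

lemma GDERIV_right_slope:
  fixes h :: "'v::real_inner \<Rightarrow> real"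
  assumes "GDERIV h x :> p"
  shows "((\<lambda>s. (h (x + s *\<^sub>R v) - h x) / s) \<longlongrightarrow> inner p v) (at_right 0)"
proof -
  have "((\<lambda>s. h (x + s *\<^sub>R v)) has_real_derivative inner p v) (at_right 0)"
    using GDERIV_directional[of h x 0 v p] assms by (auto intro: DERIV_subset)
  then show ?thesis
    by (simp add: has_field_derivative_iff)
qed

lemma GDERIV_imp_continuous_on:
  assumes "\<And>x. x \<in> S \<Longrightarrow> GDERIV h x :> p x"
  shows "continuous_on S h"
  using assms
  by (intro continuous_at_imp_continuous_on) (auto simp: gderiv_def dest: has_derivative_continuous)

lemma segment_point_eq:
  fixes x y :: "'v::real_vector"
  shows "x + s *\<^sub>R (y - x) = (1 - s) *\<^sub>R x + s *\<^sub>R y"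
  by (simp add: algebra_simps)

lemma convex_segment_mem:
  assumes "convex S" "x \<in> S" "y \<in> S" "0 \<le> s" "s \<le> 1"
  shows "x + s *\<^sub>R (y - x) \<in> S"
  unfolding segment_point_eq using assms by (rule convexD_alt)

lemma convex_on_segment_le:
  assumes "convex_on S h" "x \<in> S" "y \<in> S" "0 \<le> s" "s \<le> 1"
  shows "h (x + s *\<^sub>R (y - x)) \<le> h x + s * (h y - h x)"
  unfolding segment_point_eq using convex_onD[OF assms(1,4,5,2,3)]
  by (simp add: left_diff_distrib right_diff_distrib)

lemma descent_lemma:
  fixes h :: "'v::real_inner \<Rightarrow> real"
  assumes convex: "convex S" and gradient: "\<And>z. z \<in> S \<Longrightarrow> GDERIV h z :> p z"
    and lipschitz: "L-lipschitz_on S p" and x_mem: "x \<in> S" and y_mem: "y \<in> S"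
  shows "h y \<le> h x + inner (p x) (y - x) + L / 2 * (norm (y - x))\<^sup>2"
proof -
  let ?v = "y - x"
  define g where "g s = h (x + s *\<^sub>R ?v) - s * inner (p x) ?v - L / 2 * s\<^sup>2 * (norm ?v)\<^sup>2" for s
  have "g 1 \<le> g 0"
  proof (rule DERIV_nonpos_imp_nonincreasing[of 0 1 g])
    fix s :: real
    assume s_range: "0 \<le> s" "s \<le> 1"
    then have segment: "x + s *\<^sub>R ?v \<in> S"
      by (intro convex_segment_mem convex x_mem y_mem)
    let ?D = "inner (p (x + s *\<^sub>R ?v)) ?v - inner (p x) ?v - L * s * (norm ?v)\<^sup>2"
    have "DERIV g s :> ?D"
      unfolding g_def
      by (auto intro!: derivative_eq_intros GDERIV_directional gradient segment)
    moreover have "?D \<le> 0"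
    proof -
      have "inner (p (x + s *\<^sub>R ?v) - p x) ?v \<le> norm (p (x + s *\<^sub>R ?v) - p x) * norm ?v"
        by (rule norm_cauchy_schwarz)
      also have "\<dots> \<le> L * norm (s *\<^sub>R ?v) * norm ?v"
        using lipschitz_on_normD[OF lipschitz segment x_mem] by (intro mult_right_mono) auto
      finally show ?thesis
        using s_range by (simp add: inner_diff_left power2_eq_square mult.assoc)
    qed
    ultimately show "\<exists>D. DERIV g s :> D \<and> D \<le> 0"
      by blast
  qed simp
  then show ?thesis
    by (simp add: g_def)
qed

subsection \<open>Composite variational inequalities\<close>

text \<open>The first-order optimality condition for minimizing \<open>h + r\<close> over \<open>S\<close>, with \<open>p\<close> the gradient
  of \<open>h\<close> at \<open>z\<close>.\<close>

definition vi_solution :: "'v::real_inner set \<Rightarrow> ('v \<Rightarrow> real) \<Rightarrow> 'v \<Rightarrow> 'v \<Rightarrow> bool" where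
  "vi_solution S r p z \<longleftrightarrow> z \<in> S \<and> (\<forall>y\<in>S. 0 \<le> inner p (y - z) + r y - r z)"

lemma vi_solutionD:
  assumes "vi_solution S r p z"
  shows "z \<in> S" "y \<in> S \<Longrightarrow> 0 \<le> inner p (y - z) + r y - r z"
  using assms by (auto simp: vi_solution_def)

lemma vi_solution_of_minimizer:
  fixes h r :: "'v::real_inner \<Rightarrow> real"
  assumes r_convex: "convex_on S r" and z_mem: "z \<in> S" and gradient: "GDERIV h z :> p"
    and minimal: "\<And>y. y \<in> S \<Longrightarrow> h z + r z \<le> h y + r y"
  shows "vi_solution S r p z"
  unfolding vi_solution_def
proof (intro conjI ballI z_mem)
  fix y
  assume y_mem: "y \<in> S"
  have "- (r y - r z) \<le> inner p (y - z)"
  proof (rule tendsto_lowerbound[OF GDERIV_right_slope[OF gradient]])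
    show "\<forall>\<^sub>F s in at_right 0. - (r y - r z) \<le> (h (z + s *\<^sub>R (y - z)) - h z) / s"
      using eventually_at_right_real[OF zero_less_one]
    proof (rule eventually_mono)
      fix s :: real
      assume s_range: "s \<in> {0<..<1}"
      then have "h z + r z \<le> h (z + s *\<^sub>R (y - z)) + r (z + s *\<^sub>R (y - z))"
        by (intro minimal convex_segment_mem convex_on_imp_convex[OF r_convex] z_mem y_mem) auto
      also have "r (z + s *\<^sub>R (y - z)) \<le> r z + s * (r y - r z)"
        using s_range by (intro convex_on_segment_le[OF r_convex z_mem y_mem]) auto
      finally have "- (r y - r z) * s \<le> h (z + s *\<^sub>R (y - z)) - h z"
        by (simp add: algebra_simps)
      then show "- (r y - r z) \<le> (h (z + s *\<^sub>R (y - z)) - h z) / s"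
        using s_range by (simp add: pos_le_divide_eq)
    qed
  qed simp
  then show "0 \<le> inner p (y - z) + r y - r z"
    by simp
qed

text \<open>Every point of \<open>S\<close> minimizes \<open>- h + h\<close>.\<close>

lemma convex_on_above_tangent:
  fixes h :: "'v::real_inner \<Rightarrow> real"
  assumes h_convex: "convex_on S h" and x_mem: "x \<in> S" and y_mem: "y \<in> S"
    and gradient: "GDERIV h x :> p"
  shows "h x + inner p (y - x) \<le> h y"
proof -
  have "vi_solution S h (- p) x"
    by (rule vi_solution_of_minimizer[OF h_convex x_mem GDERIV_minus[OF gradient]]) simp
  from vi_solutionD(2)[OF this y_mem] show ?thesis
    by simp
qed

lemma convex_on_power2_norm:
  fixes S :: "'v::real_inner set"
  assumes "convex S"
  shows "convex_on S (\<lambda>z. (norm z)\<^sup>2)"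
proof (rule convex_onI[OF _ assms])
  fix t :: real and x y :: 'v
  assume t_range: "0 < t" "t < 1"
  have "(1 - t) * (norm x)\<^sup>2 + t * (norm y)\<^sup>2 - (norm ((1 - t) *\<^sub>R x + t *\<^sub>R y))\<^sup>2
      = t * (1 - t) * (norm (x - y))\<^sup>2"
    unfolding power2_norm_eq_inner by (simp add: inner_add inner_diff inner_commute algebra_simps)
  also have "\<dots> \<ge> 0"
    using t_range by simp
  finally show "(norm ((1 - t) *\<^sub>R x + t *\<^sub>R y))\<^sup>2 \<le> (1 - t) * (norm x)\<^sup>2 + t * (norm y)\<^sup>2"
    by simp
qed

lemma strongly_convex_on_mono:
  assumes "strongly_convex_on c S h" "c' \<le> c"
  shows "strongly_convex_on c' S h"
proof -
  have "convex_on S (\<lambda>z. (h z - c / 2 * (norm z)\<^sup>2) + (c - c') / 2 * (norm z)\<^sup>2)"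
    using assms unfolding strongly_convex_on_def
    by (intro convex_on_add convex_on_cmul convex_on_power2_norm convex_on_imp_convex) auto
  then show ?thesis
    by (simp add: strongly_convex_on_def algebra_simps diff_divide_distrib)
qed

lemma strongly_convex_on_above_tangent:
  fixes h :: "'v::real_inner \<Rightarrow> real"
  assumes h_convex: "strongly_convex_on c S h" and x_mem: "x \<in> S" and y_mem: "y \<in> S"
    and gradient: "GDERIV h x :> p"
  shows "h x + inner p (y - x) + c / 2 * (norm (y - x))\<^sup>2 \<le> h y"
proof -
  have "GDERIV (\<lambda>z. h z - c / 2 * (norm z)\<^sup>2) x :> p - c *\<^sub>R x"
    using gradient unfolding gderiv_def power2_norm_eq_inner
    by (auto intro!: derivative_eq_intros simp: inner_diff_right inner_commute)
  from convex_on_above_tangent[OF h_convex[unfolded strongly_convex_on_def] x_mem y_mem this]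
  show ?thesis
    by (simp add: power2_norm_eq_inner inner_diff_left inner_diff_right inner_commute algebra_simps)
qed

lemma strongly_convex_on_gradient_monotone:
  fixes h :: "'v::real_inner \<Rightarrow> real"
  assumes h_convex: "strongly_convex_on c S h" and x_mem: "x \<in> S" and y_mem: "y \<in> S"
    and x_gradient: "GDERIV h x :> p" and y_gradient: "GDERIV h y :> q"
  shows "c * (norm (x - y))\<^sup>2 \<le> inner (p - q) (x - y)"
  using strongly_convex_on_above_tangent[OF h_convex x_mem y_mem x_gradient]
    strongly_convex_on_above_tangent[OF h_convex y_mem x_mem y_gradient]
  by (simp add: inner_diff_left inner_diff_right norm_minus_commute)

lemma vi_solution_descent:
  fixes h r :: "'v::real_inner \<Rightarrow> real"
  assumes h_convex: "strongly_convex_on c S h"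
    and x_gradient: "GDERIV h x :> p" and z_gradient: "GDERIV h z :> p'"
    and solution: "vi_solution S r (p' + q) z" and x_mem: "x \<in> S"
  shows "inner (p + q) (z - x) + r z - r x \<le> - c * (norm (z - x))\<^sup>2"
proof -
  have "c * (norm (z - x))\<^sup>2 \<le> inner (p' - p) (z - x)"
    by (rule strongly_convex_on_gradient_monotone[OF h_convex vi_solutionD(1)[OF solution]
          x_mem z_gradient x_gradient])
  also have "\<dots> \<le> - (inner (p + q) (z - x) + r z - r x)"
    using vi_solutionD(2)[OF solution x_mem]
    by (simp add: inner_diff_left inner_diff_right inner_add_left)
  finally show ?thesis
    by simp
qed

lemma vi_solution_perturbation:
  fixes h r :: "'v::real_inner \<Rightarrow> real"
  assumes h_convex: "strongly_convex_on c S h"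
    and z_gradient: "GDERIV h z :> p" and z'_gradient: "GDERIV h z' :> p'"
    and z_solution: "vi_solution S r (p + q) z" and z'_solution: "vi_solution S r (p' + q') z'"
  shows "c * norm (z - z') \<le> norm (q - q')"
proof (cases "z = z'")
  case False
  note mem = vi_solutionD(1)[OF z_solution] vi_solutionD(1)[OF z'_solution]
  have "c * (norm (z - z'))\<^sup>2 \<le> inner (p - p') (z - z')"
    by (rule strongly_convex_on_gradient_monotone[OF h_convex mem z_gradient z'_gradient])
  also have "\<dots> \<le> inner (q - q') (z' - z)"
    using vi_solutionD(2)[OF z_solution mem(2)] vi_solutionD(2)[OF z'_solution mem(1)]
    by (simp add: inner_diff_left inner_diff_right inner_add_left)
  also have "\<dots> \<le> norm (q - q') * norm (z' - z)"
    by (rule norm_cauchy_schwarz)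
  finally show ?thesis
    using False by (simp add: power2_eq_square norm_minus_commute flip: mult.assoc)
qed simp

subsection \<open>Subgradients\<close>

lemma convex_strict_epigraph:
  fixes r :: "'v::real_vector \<Rightarrow> real"
  assumes r_convex: "convex_on UNIV r"
  shows "convex {(x, s). r x < s}"
proof -
  have slack: "convex_on UNIV (\<lambda>p. r (fst p) - snd p)"
  proof (rule convex_onI)
    fix t :: real and p p' :: "'v \<times> real"
    assume "0 < t" "t < 1"
    then show "r (fst ((1 - t) *\<^sub>R p + t *\<^sub>R p')) - snd ((1 - t) *\<^sub>R p + t *\<^sub>R p')
        \<le> (1 - t) * (r (fst p) - snd p) + t * (r (fst p') - snd p')"
      using convex_onD[OF r_convex, of t "fst p" "fst p'"] by (simp add: right_diff_distrib)
  qed simp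
  have "convex {p. r (fst p) - snd p < 0}"
  proof (rule convexI)
    fix p p' :: "'v \<times> real" and u v :: real
    assume "p \<in> {p. r (fst p) - snd p < 0}" "p' \<in> {p. r (fst p) - snd p < 0}"
      and "0 \<le> u" "0 \<le> v" "u + v = 1"
    then show "u *\<^sub>R p + v *\<^sub>R p' \<in> {p. r (fst p) - snd p < 0}"
      using convex_lower[OF slack, of p p' u v] by (auto simp: max_def split: if_splits)
  qed
  then show ?thesis
    by (simp add: case_prod_beta')
qed

lemma subgradient_exists:
  fixes r :: "'v::euclidean_space \<Rightarrow> real"
  assumes r_convex: "convex_on UNIV r"
  shows "\<exists>g. is_subgradient r z g"
proof -
  have "{(x, s). r x < s} \<noteq> {}" "{(z, r z)} \<inter> {(x, s). r x < s} = {}"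
    by (auto intro!: exI[of _ z] exI[of _ "r z + 1"])
  from separating_hyperplane_sets[OF convex_singleton convex_strict_epigraph[OF r_convex] _ this]
  obtain a b where a_nonzero: "a \<noteq> 0" and hyperplane: "\<forall>x\<in>{(z, r z)}. inner a x \<le> b"
      "\<forall>x\<in>{(x, s). r x < s}. b \<le> inner a x"
    by blast
  obtain p \<alpha> where a_eq: "a = (p, \<alpha>)"
    by (cases a)
  have separation: "inner p z + \<alpha> * r z \<le> inner p x + \<alpha> * s" if "r x < s" for x s
    using hyperplane(1) hyperplane(2)[rule_format, of "(x, s)"] that by (simp add: a_eq)
  have "0 \<le> \<alpha>"
    using separation[of z "r z + 1"] by (simp add: distrib_left)
  moreover have "\<alpha> \<noteq> 0"
  proof
    assume "\<alpha> = 0"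
    with separation[of "z - p" "r (z - p) + 1"] have "inner p p \<le> 0"
      by (simp add: inner_diff_right)
    then have "p = 0"
      using inner_gt_zero_iff[of p] by fastforce
    with \<open>\<alpha> = 0\<close> a_nonzero a_eq show False
      by (simp add: zero_prod_def)
  qed
  ultimately have \<alpha>_pos: "\<alpha> > 0"
    by simp
  have "r z + inner (- (1 / \<alpha>) *\<^sub>R p) (x - z) \<le> r x" for x
  proof (rule dense_ge)
    fix s
    assume "r x < s"
    then have "\<alpha> * (r z + inner (- (1 / \<alpha>) *\<^sub>R p) (x - z)) \<le> \<alpha> * s"
      using separation[of x s] \<alpha>_pos by (simp add: algebra_simps inner_diff_right)
    then show "r z + inner (- (1 / \<alpha>) *\<^sub>R p) (x - z) \<le> s"
      using \<alpha>_pos by simp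
  qed
  then show ?thesis
    unfolding is_subgradient_def by blast
qed

lemma diff_le_of_subgradient_bound:
  fixes r :: "'v::euclidean_space \<Rightarrow> real"
  assumes r_convex: "convex_on UNIV r" and bound: "\<And>g. is_subgradient r z g \<Longrightarrow> norm g \<le> M"
  shows "r z - r y \<le> M * norm (z - y)"
proof -
  obtain g where subgradient: "is_subgradient r z g"
    using subgradient_exists[OF r_convex] by blast
  then have "r z - r y \<le> inner g (z - y)"
    by (auto simp: is_subgradient_def inner_diff_right dest: spec[of _ y])
  also have "\<dots> \<le> norm g * norm (z - y)"
    by (rule norm_cauchy_schwarz)
  also have "\<dots> \<le> M * norm (z - y)"
    by (intro mult_right_mono bound subgradient) simp
  finally show ?thesis .
qed

subsection \<open>Existence of minimizers\<close>

lemma continuous_attains_inf_of_far_ge: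
  fixes F :: "'v::heine_borel \<Rightarrow> real"
  assumes closed: "closed S" and continuous: "continuous_on S F" and a_mem: "a \<in> S"
    and far: "\<And>x. x \<in> S \<Longrightarrow> R \<le> dist c x \<Longrightarrow> F a \<le> F x"
  shows "\<exists>x\<in>S. \<forall>y\<in>S. F x \<le> F y"
proof -
  let ?B = "S \<inter> cball c (max R (dist c a))"
  have "compact ?B" "a \<in> ?B" "continuous_on ?B F"
    using closed a_mem continuous by (auto intro: closed_Int_compact continuous_on_subset)
  then obtain x where x_mem: "x \<in> ?B" and minimal: "\<And>y. y \<in> ?B \<Longrightarrow> F x \<le> F y"
    using continuous_attains_inf[of ?B F] by blast
  have "F x \<le> F y" if "y \<in> S" for y
    using minimal[of y] minimal[of a] far[of y] that a_mem by fastforce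
  then show ?thesis
    using x_mem by blast
qed

lemma coercive_on_attains_inf:
  fixes F :: "'v::{real_normed_vector, heine_borel} \<Rightarrow> real"
  assumes closed: "closed S" and nonempty: "S \<noteq> {}"
    and continuous: "continuous_on S F" and coercive: "coercive_on S F"
  shows "\<exists>x\<in>S. \<forall>y\<in>S. F x \<le> F y"
proof -
  obtain a where a_mem: "a \<in> S"
    using nonempty by blast
  obtain R where "\<And>x. x \<in> S \<Longrightarrow> R \<le> norm x \<Longrightarrow> F a \<le> F x"
    using coercive unfolding coercive_on_def by blast
  then show ?thesis
    by (intro continuous_attains_inf_of_far_ge[OF closed continuous a_mem, of R 0]) simp
qed

lemma strongly_convex_attains_inf:
  fixes h r :: "'v::euclidean_space \<Rightarrow> real"
  assumes closed: "closed S" and nonempty: "S \<noteq> {}"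
    and c_pos: "c > 0" and h_convex: "strongly_convex_on c S h"
    and gradient: "\<And>z. z \<in> S \<Longrightarrow> GDERIV h z :> p z" and r_convex: "convex_on UNIV r"
  shows "\<exists>x\<in>S. \<forall>z\<in>S. h x + r x \<le> h z + r z"
proof -
  obtain a where a_mem: "a \<in> S"
    using nonempty by blast
  obtain g where subgradient: "is_subgradient r a g"
    using subgradient_exists[OF r_convex] by blast
  have "continuous_on S (\<lambda>z. h z + r z)"
    by (intro continuous_on_add GDERIV_imp_continuous_on[OF gradient]
        continuous_on_subset[OF convex_on_continuous[OF open_UNIV r_convex] subset_UNIV])
  moreover have "h a + r a \<le> h z + r z"
    if z_mem: "z \<in> S" and far: "2 * norm (p a + g) / c \<le> dist a z" for z
  proof -
    let ?d = "norm (z - a)"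
    have "0 \<le> (c / 2 * ?d - norm (p a + g)) * ?d"
      using far c_pos
      by (intro mult_nonneg_nonneg) (auto simp: dist_norm norm_minus_commute field_simps)
    also have "\<dots> \<le> inner (p a + g) (z - a) + c / 2 * ?d\<^sup>2"
      using Cauchy_Schwarz_ineq2[of "p a + g" "z - a"] by (simp add: algebra_simps power2_eq_square)
    also have "\<dots> \<le> (h z - h a) + (r z - r a)"
      using strongly_convex_on_above_tangent[OF h_convex a_mem z_mem gradient[OF a_mem]] subgradient
      by (auto simp: is_subgradient_def inner_add_left dest: spec[of _ z])
    finally show ?thesis
      by simp
  qed
  ultimately show ?thesis
    by (rule continuous_attains_inf_of_far_ge[OF closed _ a_mem])
qed

lemma vi_solution_exists:
  fixes h r :: "'v::euclidean_space \<Rightarrow> real"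
  assumes closed: "closed S" and convex: "convex S" and nonempty: "S \<noteq> {}"
    and c_pos: "c > 0" and h_convex: "strongly_convex_on c S h"
    and gradient: "\<And>z. z \<in> S \<Longrightarrow> GDERIV h z :> p z" and r_convex: "convex_on UNIV r"
  shows "\<exists>z. vi_solution S r (p z + q) z"
proof -
  have "convex_on UNIV (\<lambda>z. inner q z)"
    by (auto simp: convex_on_def inner_add_right)
  then have "convex_on UNIV (\<lambda>z. inner q z + r z)"
    by (rule convex_on_add[OF _ r_convex])
  from strongly_convex_attains_inf[OF closed nonempty c_pos h_convex gradient this]
  obtain z where z_mem: "z \<in> S"
      and minimal: "\<And>y. y \<in> S \<Longrightarrow> h z + (inner q z + r z) \<le> h y + (inner q y + r y)"
    by blast
  have "vi_solution S r (p z + q) z"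
  proof (rule vi_solution_of_minimizer[where h = "\<lambda>z. h z + inner q z"])
    show "convex_on S r"
      using r_convex convex convex_on_subset by blast
    show "GDERIV (\<lambda>z. h z + inner q z) z :> p z + q"
      using gradient[OF z_mem] unfolding gderiv_def
      by (auto intro!: derivative_eq_intros simp: inner_add_right inner_commute)
  qed (use z_mem minimal in \<open>auto simp: add.assoc\<close>)
  then show ?thesis
    by blast
qed

section \<open>Uniform constants over finite families\<close>

lemma uniform_constant:
  fixes P :: "'i::finite \<Rightarrow> real \<Rightarrow> bool"
  assumes exists: "\<And>i. \<exists>c. P i c" and mono: "\<And>i c c'. P i c \<Longrightarrow> c \<le> c' \<Longrightarrow> P i c'"
  shows "\<exists>c. \<forall>i. P i c"
proof -
  have "eventually (P i) at_top" for i
    using exists[of i] mono unfolding eventually_at_top_linorder by blast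
  then have "eventually (\<lambda>c. \<forall>i. P i c) at_top"
    by (rule eventually_all_finite)
  then show ?thesis
    using eventually_happens' trivial_limit_at_top_linorder by blast
qed

lemma uniform_bound_on:
  fixes g :: "'i::finite \<Rightarrow> 'v \<Rightarrow> 'w::real_normed_vector"
  assumes "\<And>i. bounded (g i ` S)"
  shows "\<exists>B. \<forall>i. \<forall>x\<in>S. norm (g i x) \<le> B"
proof (rule uniform_constant)
  show "\<exists>B. \<forall>x\<in>S. norm (g i x) \<le> B" for i
    using assms[of i] by (simp add: bounded_iff)
qed (blast intro: order_trans)

lemma uniform_lipschitz_on:
  fixes g :: "'i::finite \<Rightarrow> 'v::metric_space \<Rightarrow> 'w::metric_space"
  assumes "\<And>i. \<exists>L. L-lipschitz_on S (g i)"
  shows "\<exists>L. \<forall>i. L-lipschitz_on S (g i)"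
  by (rule uniform_constant) (blast intro: assms lipschitz_on_le)+

lemma uniform_lipschitz_on_family:
  fixes g :: "'i::finite \<Rightarrow> 'l::finite \<Rightarrow> 'z \<Rightarrow> 'v::metric_space \<Rightarrow> 'w::metric_space"
  assumes "\<And>i l. \<exists>L. \<forall>z\<in>Z l. L-lipschitz_on S (g i l z)"
  shows "\<exists>L. \<forall>i l. \<forall>z\<in>Z l. L-lipschitz_on S (g i l z)"
proof (rule uniform_constant)
  show "\<exists>L. \<forall>l. \<forall>z\<in>Z l. L-lipschitz_on S (g i l z)" for i
    by (rule uniform_constant[OF assms]) (blast intro: lipschitz_on_le)
qed (blast intro: lipschitz_on_le)

lemma uniform_diff_le_of_subgradient_bound:
  fixes r :: "'i::finite \<Rightarrow> 'v::euclidean_space \<Rightarrow> real"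
  assumes r_convex: "\<And>i. convex_on UNIV (r i)"
    and bound: "\<And>i. \<exists>M. \<forall>z\<in>S i. \<forall>g. is_subgradient (r i) z g \<longrightarrow> norm g \<le> M"
  shows "\<exists>M. \<forall>i. \<forall>z\<in>S i. \<forall>y. r i z - r i y \<le> M * norm (z - y)"
proof (rule uniform_constant)
  show "\<exists>M. \<forall>z\<in>S i. \<forall>y. r i z - r i y \<le> M * norm (z - y)" for i
    using bound[of i] diff_le_of_subgradient_bound[OF r_convex] by meson
qed (meson mult_right_mono norm_ge_zero order_trans)

lemma uniform_positive_lower_bound:
  fixes \<tau> :: "'i::finite \<Rightarrow> real"
  assumes "\<And>i. 0 < \<tau> i"
  shows "\<exists>\<mu>>0. \<forall>i. \<mu> \<le> \<tau> i"
  using assms by (intro exI[of _ "Min (range \<tau>)"]) auto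

lemma uniform_window:
  fixes sel :: "nat \<Rightarrow> 'i::finite \<Rightarrow> 'l"
  assumes "\<And>i. \<exists>T>0. \<forall>t. (\<Union>s<T. {sel (t + s) i}) = UNIV"
  shows "\<exists>T. \<forall>t i l. \<exists>s<T. sel (t + s) i = l"
proof -
  obtain T where covers: "\<And>i t. (\<Union>s<T i. {sel (t + s) i}) = UNIV"
    using assms by metis
  have "\<exists>s<Max (range T). sel (t + s) i = l" for t i l
  proof -
    have "l \<in> (\<Union>s<T i. {sel (t + s) i})"
      by (simp only: covers UNIV_I)
    then obtain s where "s < T i" "sel (t + s) i = l"
      by auto
    moreover have "T i \<le> Max (range T)"
      by simp
    ultimately show ?thesis
      using less_le_trans by blast
  qed
  then show ?thesis
    by blast
qed

section \<open>Composite problems and their surrogates\<close>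

lemma norm_vec_le_sum: "norm x \<le> (\<Sum>l\<in>UNIV. norm (x $ l))"
  unfolding norm_vec_def by (rule L2_set_le_sum) simp

lemma lipschitz_on_vec_nth:
  fixes g :: "'v::metric_space \<Rightarrow> 'w::real_normed_vector ^ 'n::finite"
  assumes "C-lipschitz_on S g"
  shows "C-lipschitz_on S (\<lambda>x. g x $ l)"
proof (rule lipschitz_onI)
  show "dist (g x $ l) (g y $ l) \<le> C * dist x y" if "x \<in> S" "y \<in> S" for x y
    using dist_vec_nth_le lipschitz_onD[OF assms that] by (rule order_trans)
qed (rule lipschitz_on_nonneg[OF assms])

lemma lipschitz_on_sum:
  fixes g :: "'i \<Rightarrow> 'v::metric_space \<Rightarrow> 'w::real_normed_vector"
  assumes "\<And>i. i \<in> I \<Longrightarrow> C-lipschitz_on S (g i)"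
  shows "(real (card I) * C)-lipschitz_on S (\<lambda>x. \<Sum>i\<in>I. g i x)"
  using assms
proof (induction I rule: infinite_finite_induct)
  case (insert i I)
  then have "(C + real (card I) * C)-lipschitz_on S (\<lambda>x. g i x + (\<Sum>i\<in>I. g i x))"
    by (intro lipschitz_on_add) auto
  then show ?case
    using insert.hyps by (simp add: algebra_simps)
qed (auto intro: lipschitz_on_constant)

lemma prod_set_nth: "x \<in> prod_set Kb \<Longrightarrow> x $ l \<in> Kb l"
  by (simp add: prod_set_def)

lemma closed_prod_set:
  assumes "\<And>l. closed (Kb l)"
  shows "closed (prod_set Kb)"
proof -
  have "prod_set Kb = (\<Inter>l. (\<lambda>x. x $ l) -` Kb l)"
    by (auto simp: prod_set_def)
  then show ?thesis
    by (auto intro!: closed_INT closed_vimage assms continuous_intros)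
qed

lemma convex_prod_set:
  assumes "\<And>l. convex (Kb l)"
  shows "convex (prod_set Kb)"
  unfolding prod_set_def by (auto intro!: convexI convexD[OF assms])

definition objective ::
    "('a::finite \<Rightarrow> real^'d^'b \<Rightarrow> real) \<Rightarrow> ('b::finite \<Rightarrow> real^'d \<Rightarrow> real) \<Rightarrow> real^'d^'b \<Rightarrow> real" where
  "objective f r x = (\<Sum>i\<in>UNIV. f i x) + (\<Sum>l\<in>UNIV. r l (x $ l))"

locale composite_problem =
  fixes f :: "'a::finite \<Rightarrow> real^'d::finite^'b::finite \<Rightarrow> real"
    and gf :: "'a \<Rightarrow> real^'d^'b \<Rightarrow> real^'d^'b"
    and r :: "'b \<Rightarrow> real^'d \<Rightarrow> real"
    and Kb :: "'b \<Rightarrow> (real^'d) set"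
    and L :: real
  assumes K_ne: "Kb l \<noteq> {}"
    and K_closed: "closed (Kb l)"
    and K_convex: "convex (Kb l)"
    and f_deriv: "x \<in> prod_set Kb \<Longrightarrow> GDERIV (f i) x :> gf i x"
    and gf_lipschitz: "L-lipschitz_on (prod_set Kb) (gf i)"
    and r_convex: "convex_on UNIV (r l)"
begin

abbreviation K :: "(real^'d^'b) set" where
  "K \<equiv> prod_set Kb"

lemma closed_K: "closed K"
  by (rule closed_prod_set[OF K_closed])

lemma convex_K: "convex K"
  by (rule convex_prod_set[OF K_convex])

definition gF :: "real^'d^'b \<Rightarrow> real^'d^'b" where
  "gF x = (\<Sum>i\<in>UNIV. gf i x)"

lemma gF_deriv: "x \<in> K \<Longrightarrow> GDERIV (\<lambda>x. \<Sum>i\<in>UNIV. f i x) x :> gF x"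
  using f_deriv unfolding gderiv_def gF_def inner_sum_right by (intro has_derivative_sum) auto

lemma gF_lipschitz: "(real CARD('a) * L)-lipschitz_on K gF"
  unfolding gF_def[abs_def] by (intro lipschitz_on_sum gf_lipschitz)

lemma objective_continuous: "continuous_on K (objective f r)"
proof -
  have "continuous_on K (\<lambda>x. r l (x $ l))" for l
    by (rule continuous_on_compose2[OF convex_on_continuous[OF open_UNIV r_convex]])
      (auto intro!: continuous_intros)
  then show ?thesis
    unfolding objective_def[abs_def]
    by (intro continuous_on_add continuous_on_sum GDERIV_imp_continuous_on[OF f_deriv])
qed

end

locale surrogate_model = composite_problem f gf r Kb L
  for f :: "'a::finite \<Rightarrow> real^'d::finite^'b::finite \<Rightarrow> real" and gf r Kb L +
  fixes ft :: "'a \<Rightarrow> 'b \<Rightarrow> real^'d \<Rightarrow> real^'d^'b \<Rightarrow> real"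
    and gft :: "'a \<Rightarrow> 'b \<Rightarrow> real^'d \<Rightarrow> real^'d^'b \<Rightarrow> real^'d"
    and \<mu> Lt :: real
  assumes \<mu>_pos: "0 < \<mu>"
    and ft_deriv: "x \<in> prod_set Kb \<Longrightarrow> z \<in> Kb l \<Longrightarrow> GDERIV (\<lambda>z. ft i l z x) z :> gft i l z x"
    and ft_strong: "x \<in> prod_set Kb \<Longrightarrow> strongly_convex_on \<mu> (Kb l) (\<lambda>z. ft i l z x)"
    and ft_grad_cons: "x \<in> prod_set Kb \<Longrightarrow> gft i l (x $ l) x = gf i x $ l"
    and ft_lipschitz: "z \<in> Kb l \<Longrightarrow> Lt-lipschitz_on (prod_set Kb) (gft i l z)"
begin

abbreviation best_response :: "'a \<Rightarrow> 'b \<Rightarrow> real^'d^'b \<Rightarrow> real^'d \<Rightarrow> real^'d \<Rightarrow> bool" where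
  "best_response i l w q z \<equiv> vi_solution (Kb l) (r l) (gft i l z w + q) z"

lemma best_response_of_minimizer:
  assumes w_mem: "w \<in> K" and z_mem: "z \<in> Kb l"
    and minimal: "\<And>y. y \<in> Kb l \<Longrightarrow>
      ft i l z w + inner q (z - v) + r l z \<le> ft i l y w + inner q (y - v) + r l y"
  shows "best_response i l w q z"
proof (rule vi_solution_of_minimizer[where h = "\<lambda>z. ft i l z w + inner q (z - v)"])
  show "convex_on (Kb l) (r l)"
    using r_convex convex_on_subset K_convex by blast
  show "GDERIV (\<lambda>z. ft i l z w + inner q (z - v)) z :> gft i l z w + q"
    using ft_deriv[OF w_mem z_mem] unfolding gderiv_def
    by (auto intro!: derivative_eq_intros simp: inner_add_right inner_commute)
qed (use z_mem minimal in auto)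

lemma best_response_perturbation:
  assumes w_mem: "w \<in> K" and w'_mem: "w' \<in> K"
    and z_response: "best_response i l w q z" and z'_response: "best_response i l w' q' z'"
  shows "\<mu> * norm (z - z') \<le> Lt * norm (w - w') + norm (q - q')"
proof -
  note mem = vi_solutionD(1)[OF z_response] vi_solutionD(1)[OF z'_response]
  have "vi_solution (Kb l) (r l) (gft i l z' w + (q' + (gft i l z' w' - gft i l z' w))) z'"
    using z'_response by (simp add: add.commute)
  then have "\<mu> * norm (z - z') \<le> norm (q - (q' + (gft i l z' w' - gft i l z' w)))"
    by (rule vi_solution_perturbation[OF ft_strong[OF w_mem] ft_deriv[OF w_mem mem(1)]
        ft_deriv[OF w_mem mem(2)] z_response])
  also have "\<dots> = norm ((gft i l z' w - gft i l z' w') + (q - q'))"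
    by (simp add: algebra_simps)
  also have "\<dots> \<le> Lt * norm (w - w') + norm (q - q')"
    by (rule norm_triangle_mono[OF _ order_refl])
      (rule lipschitz_on_normD[OF ft_lipschitz[OF mem(2)] w_mem w'_mem])
  finally show ?thesis .
qed

definition others_gradient :: "'a \<Rightarrow> 'b \<Rightarrow> real^'d^'b \<Rightarrow> real^'d" where
  "others_gradient i l w = gF w $ l - gf i w $ l"

lemma others_gradient_lipschitz: "(real CARD('a) * L + L)-lipschitz_on K (others_gradient i l)"
  unfolding others_gradient_def[abs_def]
  by (intro lipschitz_on_diff lipschitz_on_vec_nth gF_lipschitz gf_lipschitz)

definition response :: "'a \<Rightarrow> 'b \<Rightarrow> real^'d^'b \<Rightarrow> real^'d" where
  "response i l w = (SOME z. best_response i l w (others_gradient i l w) z)"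

definition residual :: "'a \<Rightarrow> 'b \<Rightarrow> real^'d^'b \<Rightarrow> real^'d" where
  "residual i l w = response i l w - w $ l"

lemma best_response_response:
  assumes "w \<in> K"
  shows "best_response i l w (others_gradient i l w) (response i l w)"
  unfolding response_def
  by (rule someI_ex[OF vi_solution_exists[OF K_closed K_convex K_ne \<mu>_pos ft_strong[OF assms]
          ft_deriv[OF assms] r_convex]])

lemma response_lipschitz:
  "((Lt + (real CARD('a) * L + L)) / \<mu>)-lipschitz_on K (response i l)"
proof (rule lipschitz_onI)
  have "0 \<le> Lt"
    using K_ne[of l] ft_lipschitz[of _ l] lipschitz_on_nonneg by blast
  then show "0 \<le> (Lt + (real CARD('a) * L + L)) / \<mu>"
    using lipschitz_on_nonneg[OF others_gradient_lipschitz] \<mu>_pos by simp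
  fix w w'
  assume mem: "w \<in> K" "w' \<in> K"
  have "\<mu> * norm (response i l w - response i l w') \<le> Lt * norm (w - w')
      + norm (others_gradient i l w - others_gradient i l w')"
    by (rule best_response_perturbation[OF mem mem[THEN best_response_response]])
  also have "\<dots> \<le> (Lt + (real CARD('a) * L + L)) * norm (w - w')"
    using lipschitz_on_normD[OF others_gradient_lipschitz mem] by (simp add: algebra_simps)
  finally show "dist (response i l w) (response i l w')
      \<le> (Lt + (real CARD('a) * L + L)) / \<mu> * dist w w'"
    using \<mu>_pos by (simp add: dist_norm pos_le_divide_eq mult.commute)
qed

definition residual_lip :: real where
  "residual_lip = (Lt + (real CARD('a) * L + L)) / \<mu> + 1"

lemma residual_lipschitz: "residual_lip-lipschitz_on K (residual i l)"
  unfolding residual_def[abs_def] residual_lip_def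
  by (intro lipschitz_on_diff response_lipschitz lipschitz_on_vec_nth lipschitz_on_id)

lemma stationary_of_residual_zero:
  assumes x_mem: "x \<in> K" and zero: "\<And>l. residual i l x = 0"
  shows "stationary gf r Kb x"
  unfolding stationary_def
proof (intro conjI ballI x_mem sum_nonneg)
  fix y l
  assume y_mem: "y \<in> K"
  have "response i l x = x $ l"
    using zero[of l] by (simp add: residual_def)
  then have "vi_solution (Kb l) (r l) (gF x $ l) (x $ l)"
    using best_response_response[OF x_mem, of l i]
    by (simp add: ft_grad_cons[OF x_mem] others_gradient_def)
  from vi_solutionD(2)[OF this prod_set_nth[OF y_mem]]
  show "0 \<le> inner (\<Sum>i\<in>UNIV. gf i x $ l) (y $ l - x $ l) + r l (y $ l) - r l (x $ l)"
    by (simp add: gF_def)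
qed

end

section \<open>Block-wise gradient tracking\<close>

locale block_gradient_tracking = surrogate_model f gf r Kb L ft gft \<mu> Lt
  for f :: "'a::finite \<Rightarrow> real^'d::finite^'b::finite \<Rightarrow> real" and gf r Kb L ft gft \<mu> Lt +
  fixes G M :: real
    and E :: "('a \<times> 'a) set"
    and sel :: "nat \<Rightarrow> 'a \<Rightarrow> 'b"
    and T :: nat
    and A :: "'b \<Rightarrow> nat \<Rightarrow> 'a \<Rightarrow> 'a \<Rightarrow> real"
    and \<kappa> :: real
    and \<gamma> :: "nat \<Rightarrow> real"
    and X Y :: "nat \<Rightarrow> 'a \<Rightarrow> real^'d^'b"
    and \<Phi> :: "nat \<Rightarrow> 'a \<Rightarrow> 'b \<Rightarrow> real"
    and Xt :: "nat \<Rightarrow> 'a \<Rightarrow> real^'d"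
  assumes gf_bound: "x \<in> prod_set Kb \<Longrightarrow> norm (gf i x) \<le> G"
    and r_bound: "z \<in> Kb l \<Longrightarrow> r l z - r l y \<le> M * norm (z - y)"
    and objective_coercive: "coercive_on (prod_set Kb) (objective f r)"
    and E_strong: "(i, j) \<in> E\<^sup>*"
    and E_loops: "(i, i) \<in> E"
    and sel_window: "\<exists>s<T. sel (t + s) i = l"
    and \<kappa>_pos: "\<kappa> > 0"
    and A_pos: "(j, i) \<in> edges_block E (sel t) l \<Longrightarrow> A l t i j > \<kappa>"
    and A_zero: "(j, i) \<notin> edges_block E (sel t) l \<Longrightarrow> A l t i j = 0"
    and A_colstoch: "(\<Sum>i\<in>UNIV. A l t i j) = 1"
    and \<gamma>_pos: "0 < \<gamma> t" and \<gamma>_le1: "\<gamma> t \<le> 1"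
    and \<gamma>_decr: "\<gamma> (Suc t) \<le> \<gamma> t"
    and \<gamma>_not_summable: "\<not> summable \<gamma>"
    and \<gamma>_sq_summable: "summable (\<lambda>t. (\<gamma> t)\<^sup>2)"
    and init_X: "X 0 i \<in> prod_set Kb"
    and init_Y: "Y 0 i = gf i (X 0 i)"
    and init_\<Phi>: "\<Phi> 0 i l = 1"
    and Xt_mem: "Xt t i \<in> Kb (sel t i)"
    and Xt_min: "z \<in> Kb (sel t i) \<Longrightarrow>
        ft i (sel t i) (Xt t i) (X t i)
          + inner (real CARD('a) *\<^sub>R (Y t i $ sel t i) - gf i (X t i) $ sel t i)
              (Xt t i - X t i $ sel t i)
          + r (sel t i) (Xt t i)
        \<le> ft i (sel t i) z (X t i)
          + inner (real CARD('a) *\<^sub>R (Y t i $ sel t i) - gf i (X t i) $ sel t i)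
              (z - X t i $ sel t i)
          + r (sel t i) z"
    and upd_\<Phi>: "\<Phi> (Suc t) i l = (\<Sum>j\<in>nbr_block E (sel t) i l. A l t i j * \<Phi> t j l)"
    and upd_X: "X (Suc t) i $ l =
        (\<Sum>j\<in>nbr_block E (sel t) i l. (A l t i j * \<Phi> t j l / \<Phi> (Suc t) i l) *\<^sub>R
           (X t j $ l + \<gamma> t *\<^sub>R (if l = sel t j then Xt t j - X t j $ l else 0)))"
    and upd_Y: "Y (Suc t) i $ l =
        (\<Sum>j\<in>nbr_block E (sel t) i l. (A l t i j / \<Phi> (Suc t) i l) *\<^sub>R
           (\<Phi> t j l *\<^sub>R (Y t j $ l) + gf j (X (Suc t) j) $ l - gf j (X t j) $ l))"
begin

lemma \<gamma>_nonneg: "0 \<le> \<gamma> t"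
  using \<gamma>_pos[of t] by simp

lemma \<gamma>_decseq: "decseq \<gamma>"
  by (simp add: decseq_SucI \<gamma>_decr)

lemma \<gamma>_square_summable: "square_summable \<gamma>"
  using \<gamma>_sq_summable by (simp add: square_summable_def)

subsection \<open>The updates as push-sum steps\<close>

lemma sum_nbr_block:
  assumes "\<And>j. A l t i j = 0 \<Longrightarrow> h j = 0"
  shows "(\<Sum>j\<in>nbr_block E (sel t) i l. h j) = (\<Sum>j\<in>UNIV. h j)"
  by (rule sum.mono_neutral_left) (auto intro!: assms A_zero simp: edges_block_def)

sublocale mix: push_sum "A l" E \<kappa> T "\<lambda>t i. \<Phi> t i l" for l
proof
  show "0 \<le> A l t i j" for t i j
    using A_pos[of j i t l] A_zero[of j i t l] \<kappa>_pos
    by (cases "(j, i) \<in> edges_block E (sel t) l") auto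
  show "\<kappa> \<le> A l t i i" for t i
    by (rule less_imp_le, rule A_pos) (simp add: edges_block_def nbr_block_def E_loops)
  show "\<exists>s<T. \<kappa> \<le> A l (t + s) i j" if "(j, i) \<in> E" for t i j
  proof -
    obtain s where active: "s < T" "sel (t + s) j = l"
      using sel_window by blast
    then have "(j, i) \<in> edges_block E (sel (t + s)) l"
      using that by (simp add: edges_block_def nbr_block_def)
    then show ?thesis
      using A_pos active by (meson less_imp_le)
  qed
  show "\<Phi> (Suc t) i l = (\<Sum>j\<in>UNIV. A l t i j * \<Phi> t j l)" for t i
    unfolding upd_\<Phi> by (rule sum_nbr_block) simp
qed (auto simp: \<kappa>_pos E_strong A_colstoch init_\<Phi>)

definition \<Delta> :: "nat \<Rightarrow> 'a \<Rightarrow> 'b \<Rightarrow> real^'d" where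
  "\<Delta> t j l = (if l = sel t j then Xt t j - X t j $ l else 0)"

definition gf_increment :: "nat \<Rightarrow> 'a \<Rightarrow> 'b \<Rightarrow> real^'d" where
  "gf_increment t j l = gf j (X (Suc t) j) $ l - gf j (X t j) $ l"

lemma X_Suc: "X (Suc t) i $ l = (\<Sum>j\<in>UNIV. mix.weight l t i j *\<^sub>R (X t j $ l + \<gamma> t *\<^sub>R \<Delta> t j l))"
  unfolding upd_X \<Delta>_def mix.weight_def by (rule sum_nbr_block) simp

lemma Y_Suc:
  "Y (Suc t) i $ l
    = (\<Sum>j\<in>UNIV. mix.weight l t i j *\<^sub>R (Y t j $ l + (1 / \<Phi> t j l) *\<^sub>R gf_increment t j l))"
proof -
  have "Y (Suc t) i $ l = (\<Sum>j\<in>UNIV. (A l t i j / \<Phi> (Suc t) i l) *\<^sub>R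
      (\<Phi> t j l *\<^sub>R (Y t j $ l) + gf j (X (Suc t) j) $ l - gf j (X t j) $ l))"
    unfolding upd_Y by (rule sum_nbr_block) simp
  moreover have "(A l t i j / \<Phi> (Suc t) i l) *\<^sub>R
      (\<Phi> t j l *\<^sub>R (Y t j $ l) + gf j (X (Suc t) j) $ l - gf j (X t j) $ l)
    = mix.weight l t i j *\<^sub>R (Y t j $ l + (1 / \<Phi> t j l) *\<^sub>R gf_increment t j l)" for j
    using mix.\<phi>_pos[of t j l]
    by (simp add: mix.weight_def gf_increment_def scaleR_add_right scaleR_diff_right)
  ultimately show ?thesis
    by simp
qed

lemma X_in_K: "X t i \<in> K"
proof (induction t arbitrary: i)
  case (Suc t)
  have "X t j $ l + \<gamma> t *\<^sub>R \<Delta> t j l \<in> Kb l" for j l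
  proof (cases "l = sel t j")
    case True
    then show ?thesis
      using convex_segment_mem[OF K_convex, of "X t j $ l" l "Xt t j" "\<gamma> t"]
      by (simp add: \<Delta>_def prod_set_nth[OF Suc] Xt_mem \<gamma>_nonneg \<gamma>_le1)
  qed (simp add: \<Delta>_def prod_set_nth[OF Suc])
  then show ?case
    unfolding prod_set_def X_Suc mem_Collect_eq
    by (intro allI convex_sum K_convex mix.weight_sum mix.weight_nonneg) auto
qed (rule init_X)

lemma X_block_in_K: "X t i $ l \<in> Kb l"
  by (rule prod_set_nth[OF X_in_K])

lemma Y_mean: "mix.mean l t (\<lambda>i. Y t i $ l) = (1 / real CARD('a)) *\<^sub>R (\<Sum>i\<in>UNIV. gf i (X t i) $ l)"
proof (induction t)
  case 0
  then show ?case
    by (simp add: mix.mean_def init_\<Phi> init_Y scaleR_sum_right)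
next
  case (Suc t)
  have "mix.mean l t (\<lambda>j. (1 / \<Phi> t j l) *\<^sub>R gf_increment t j l)
      = (\<Sum>j\<in>UNIV. (1 / real CARD('a)) *\<^sub>R gf_increment t j l)"
    unfolding mix.mean_def
  proof (rule sum.cong[OF refl])
    show "(\<Phi> t j l / real CARD('a)) *\<^sub>R (1 / \<Phi> t j l) *\<^sub>R gf_increment t j l
        = (1 / real CARD('a)) *\<^sub>R gf_increment t j l" for j
      using mix.\<phi>_pos[of t j l] by simp
  qed
  then show ?case
    unfolding Y_Suc mix.mean_mix mix.mean_add
    by (simp add: Suc gf_increment_def sum_subtractf scaleR_diff_right flip: scaleR_sum_right)
qed

subsection \<open>Boundedness of the search directions\<close>

lemma norm_gf_nth_le: "x \<in> K \<Longrightarrow> norm (gf i x $ l) \<le> G"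
  by (rule order_trans[OF Finite_Cartesian_Product.norm_nth_le gf_bound])

lemma Y_bounded: "\<exists>C. \<forall>t i. norm (Y t i $ l) \<le> C"
proof -
  have "\<exists>C. \<forall>t. spread (\<lambda>i. Y t i $ l) \<le> C"
  proof (rule mix.weights.spread_bounded[OF Y_Suc])
    fix t j
    have "norm (gf_increment t j l) \<le> G + G"
      unfolding gf_increment_def by (intro norm_triangle_le_diff add_mono norm_gf_nth_le X_in_K)
    then show "norm ((1 / \<Phi> t j l) *\<^sub>R gf_increment t j l) \<le> (G + G) / mix.\<phi>_min l"
      by (rule mix.norm_inverse_\<phi>_scaleR_le)
  qed (rule order_refl)
  then obtain C where spread_bound: "\<And>t. spread (\<lambda>i. Y t i $ l) \<le> C"
    by blast
  have "norm (Y t i $ l) \<le> G + C" for t i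
  proof -
    let ?m = "mix.mean l t (\<lambda>i. Y t i $ l)"
    have "norm (\<Sum>i\<in>UNIV. gf i (X t i) $ l) \<le> real CARD('a) * G"
      using norm_gf_nth_le[OF X_in_K] by (intro sum_norm_bound) auto
    then have "norm ?m \<le> G"
      unfolding Y_mean by (simp add: pos_divide_le_eq mult.commute)
    moreover have "norm (Y t i $ l - ?m) \<le> C"
      using mix.norm_diff_mean_le_spread[of "\<lambda>i. Y t i $ l"] spread_bound by (rule order_trans)
    ultimately show ?thesis
      using norm_triangle_sub[of "Y t i $ l" ?m] by linarith
  qed
  then show ?thesis
    by blast
qed

definition tracked_others_gradient :: "nat \<Rightarrow> 'a \<Rightarrow> 'b \<Rightarrow> real^'d" where
  "tracked_others_gradient t i l = real CARD('a) *\<^sub>R (Y t i $ l) - gf i (X t i) $ l"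

lemma best_response_Xt:
  "best_response i (sel t i) (X t i) (tracked_others_gradient t i (sel t i)) (Xt t i)"
  unfolding tracked_others_gradient_def
  by (rule best_response_of_minimizer[OF X_in_K Xt_mem Xt_min])

lemma \<Delta>_descent:
  "inner (real CARD('a) *\<^sub>R (Y t i $ l)) (\<Delta> t i l) + r l (X t i $ l + \<Delta> t i l) - r l (X t i $ l)
    \<le> - \<mu> * (norm (\<Delta> t i l))\<^sup>2"
proof (cases "l = sel t i")
  case True
  have "inner (gft i l (X t i $ l) (X t i) + tracked_others_gradient t i l) (Xt t i - X t i $ l)
      + r l (Xt t i) - r l (X t i $ l) \<le> - \<mu> * (norm (Xt t i - X t i $ l))\<^sup>2"
  proof (rule vi_solution_descent[OF ft_strong[OF X_in_K] ft_deriv ft_deriv])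
    show "best_response i l (X t i) (tracked_others_gradient t i l) (Xt t i)"
      using best_response_Xt[of t i] True by simp
  qed (use True in \<open>auto intro: X_in_K X_block_in_K Xt_mem\<close>)
  then show ?thesis
    using True by (simp add: \<Delta>_def tracked_others_gradient_def ft_grad_cons[OF X_in_K])
qed (simp add: \<Delta>_def)

lemma \<Delta>_bounded: "\<exists>C. \<forall>t i. norm (\<Delta> t i l) \<le> C"
proof -
  obtain C where Y_bound: "\<And>t i. norm (Y t i $ l) \<le> C"
    using Y_bounded by blast
  have "norm (\<Delta> t i l) \<le> \<bar>real CARD('a) * C + M\<bar> / \<mu>" for t i
  proof (cases "\<Delta> t i l = 0")
    case True
    then show ?thesis
      using \<mu>_pos by simp
  next
    case False
    let ?n = "norm (\<Delta> t i l)" and ?NY = "real CARD('a) *\<^sub>R (Y t i $ l)"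
    have "\<mu> * ?n\<^sup>2 \<le> - inner ?NY (\<Delta> t i l) + (r l (X t i $ l) - r l (X t i $ l + \<Delta> t i l))"
      using \<Delta>_descent[of t i l] by simp
    also have "\<dots> \<le> (real CARD('a) * C) * ?n + M * ?n"
    proof (rule add_mono)
      have "- inner ?NY (\<Delta> t i l) \<le> norm ?NY * ?n"
        using norm_cauchy_schwarz[of "- ?NY" "\<Delta> t i l"] by simp
      also have "\<dots> \<le> (real CARD('a) * C) * ?n"
        by (intro mult_right_mono) (auto intro: mult_left_mono Y_bound)
      finally show "- inner ?NY (\<Delta> t i l) \<le> (real CARD('a) * C) * ?n" .
      show "r l (X t i $ l) - r l (X t i $ l + \<Delta> t i l) \<le> M * ?n"
        using r_bound[OF X_block_in_K[of t i l], where y = "X t i $ l + \<Delta> t i l"] by simp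
    qed
    finally have "(\<mu> * ?n) * ?n \<le> (real CARD('a) * C + M) * ?n"
      by (simp add: power2_eq_square algebra_simps)
    then have "\<mu> * ?n \<le> real CARD('a) * C + M"
      using False by simp
    then show ?thesis
      using \<mu>_pos by (simp add: pos_le_divide_eq mult.commute)
  qed
  then show ?thesis
    by blast
qed

definition \<Delta>_max :: real where
  "\<Delta>_max = (SUP (t, i, l). norm (\<Delta> t i l))"

lemma norm_\<Delta>_le: "norm (\<Delta> t i l) \<le> \<Delta>_max"
proof -
  obtain C where block_bound: "\<And>t i l. norm (\<Delta> t i l) \<le> C l"
    using \<Delta>_bounded by metis
  have "norm (\<Delta> t i l) \<le> Max (range C)" for t i l
    by (rule order_trans[OF block_bound Max_ge]) auto
  then have "bdd_above (range (\<lambda>(t, i, l). norm (\<Delta> t i l)))"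
    by (intro bdd_aboveI2) auto
  from cSUP_upper[OF UNIV_I this, of "(t, i, l)"] show ?thesis
    by (simp add: \<Delta>_max_def)
qed

lemma \<Delta>_max_nonneg: "0 \<le> \<Delta>_max"
  by (rule order_trans[OF norm_ge_zero norm_\<Delta>_le])

definition step_max :: real where
  "step_max = real CARD('b) * \<Delta>_max"

lemma step_max_nonneg: "0 \<le> step_max"
  by (simp add: step_max_def \<Delta>_max_nonneg)

lemma norm_\<gamma>\<Delta>_le: "norm (\<gamma> t *\<^sub>R \<Delta> t j l) \<le> \<Delta>_max * \<gamma> t"
  using mult_right_mono[OF norm_\<Delta>_le \<gamma>_nonneg] by (simp add: \<gamma>_nonneg mult.commute)

subsection \<open>Consensus\<close>

definition disagreement :: "nat \<Rightarrow> real" where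
  "disagreement t = (\<Sum>l\<in>UNIV. spread (\<lambda>i. X t i $ l))"

definition sbar :: "nat \<Rightarrow> real^'d^'b" where
  "sbar t = (\<chi> l. mix.mean l t (\<lambda>i. X t i $ l))"

lemma sbar_nth: "sbar t $ l = mix.mean l t (\<lambda>i. X t i $ l)"
  by (simp add: sbar_def)

lemma disagreement_square_summable: "square_summable disagreement"
  unfolding disagreement_def[abs_def]
  by (intro square_summable_sum mix.weights.spread_square_summable[OF X_Suc norm_\<gamma>\<Delta>_le]
      square_summable_cmult \<gamma>_square_summable)

lemma norm_X_sbar_le: "norm (X t i - sbar t) \<le> disagreement t"
proof -
  have "norm (X t i - sbar t) \<le> (\<Sum>l\<in>UNIV. norm ((X t i - sbar t) $ l))"
    by (rule norm_vec_le_sum)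
  also have "\<dots> \<le> disagreement t"
    unfolding disagreement_def vector_minus_component sbar_nth
    by (intro sum_mono mix.norm_diff_mean_le_spread[of "\<lambda>i. X t i $ _"])
  finally show ?thesis .
qed

lemma consensus: "(\<lambda>t. norm (X t i - sbar t)) \<longlonglongrightarrow> 0"
proof (rule Lim_null_comparison)
  show "disagreement \<longlonglongrightarrow> 0"
    by (rule square_summable_imp_tendsto_zero[OF disagreement_square_summable])
qed (simp add: norm_X_sbar_le)

lemma norm_X_step_le: "norm (X (Suc t) i - X t i) \<le> disagreement t + step_max * \<gamma> t"
proof -
  have "norm ((X (Suc t) i - X t i) $ l) \<le> spread (\<lambda>i. X t i $ l) + \<Delta>_max * \<gamma> t" for l
    unfolding vector_minus_component X_Suc
  proof (rule norm_convex_combination_diff_le[OF mix.weight_nonneg mix.weight_sum])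
    fix j
    have "norm ((X t j $ l - X t i $ l) + \<gamma> t *\<^sub>R \<Delta> t j l) \<le> spread (\<lambda>i. X t i $ l) + \<Delta>_max * \<gamma> t"
      by (rule norm_triangle_mono[OF norm_diff_le_spread[of "\<lambda>i. X t i $ l"] norm_\<gamma>\<Delta>_le])
    then show "norm (X t j $ l + \<gamma> t *\<^sub>R \<Delta> t j l - X t i $ l)
        \<le> spread (\<lambda>i. X t i $ l) + \<Delta>_max * \<gamma> t"
      by (simp add: algebra_simps)
  qed
  then have "norm (X (Suc t) i - X t i) \<le> (\<Sum>l\<in>UNIV. spread (\<lambda>i. X t i $ l) + \<Delta>_max * \<gamma> t)"
    by (rule order_trans[OF norm_vec_le_sum sum_mono])
  then show ?thesis
    by (simp add: disagreement_def step_max_def sum.distrib mult.assoc)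
qed

lemma sbar_in_K: "sbar t \<in> K"
  unfolding prod_set_def by (simp add: sbar_nth mix.mean_in_convex K_convex X_block_in_K)

lemma sbar_Suc: "sbar (Suc t) $ l = sbar t $ l + \<gamma> t *\<^sub>R mix.mean l t (\<lambda>j. \<Delta> t j l)"
  unfolding sbar_nth X_Suc mix.mean_mix mix.mean_add mix.mean_scaleR ..

lemma norm_sbar_step_le: "norm (sbar (Suc t) - sbar t) \<le> step_max * \<gamma> t"
proof -
  have "norm ((sbar (Suc t) - sbar t) $ l) \<le> \<Delta>_max * \<gamma> t" for l
    using mix.norm_mean_diff_le[of "\<lambda>j. \<gamma> t *\<^sub>R \<Delta> t j l" 0 "\<Delta>_max * \<gamma> t" l t] norm_\<gamma>\<Delta>_le
    by (simp add: sbar_Suc mix.mean_scaleR)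
  then have "norm (sbar (Suc t) - sbar t) \<le> (\<Sum>(l::'b)\<in>UNIV. \<Delta>_max * \<gamma> t)"
    by (rule order_trans[OF norm_vec_le_sum sum_mono])
  then show ?thesis
    by (simp add: step_max_def mult.assoc)
qed

subsection \<open>Gradient tracking\<close>

lemma norm_gf_diff_nth_le: "x \<in> K \<Longrightarrow> y \<in> K \<Longrightarrow> norm (gf i x $ l - gf i y $ l) \<le> L * norm (x - y)"
  by (rule lipschitz_on_normD[OF lipschitz_on_vec_nth[OF gf_lipschitz]])

lemma L_nonneg: "0 \<le> L"
  by (rule lipschitz_on_nonneg[OF gf_lipschitz])

lemma norm_gf_X_sbar_le: "norm (gf i (X t i) $ l - gf i (sbar t) $ l) \<le> L * disagreement t"
  by (rule order_trans[OF norm_gf_diff_nth_le[OF X_in_K sbar_in_K]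
        mult_left_mono[OF norm_X_sbar_le L_nonneg]])

lemma Y_spread_square_summable: "square_summable (\<lambda>t. spread (\<lambda>i. Y t i $ l))"
proof (rule mix.weights.spread_square_summable[OF Y_Suc])
  fix t j
  have "norm (gf_increment t j l) \<le> L * (disagreement t + step_max * \<gamma> t)"
    unfolding gf_increment_def
    by (rule order_trans[OF norm_gf_diff_nth_le[OF X_in_K X_in_K]
          mult_left_mono[OF norm_X_step_le L_nonneg]])
  then show "norm ((1 / \<Phi> t j l) *\<^sub>R gf_increment t j l)
      \<le> L * (disagreement t + step_max * \<gamma> t) / mix.\<phi>_min l"
    by (rule mix.norm_inverse_\<phi>_scaleR_le)
next
  have "square_summable (\<lambda>t. L / mix.\<phi>_min l * (disagreement t + step_max * \<gamma> t))"
    by (intro square_summable_cmult square_summable_add disagreement_square_summable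
        \<gamma>_square_summable)
  then show "square_summable (\<lambda>t. L * (disagreement t + step_max * \<gamma> t) / mix.\<phi>_min l)"
    by simp
qed

definition tracking_error :: "nat \<Rightarrow> real" where
  "tracking_error t = real CARD('a) * ((\<Sum>l\<in>UNIV. spread (\<lambda>i. Y t i $ l)) + L * disagreement t)"

lemma tracking_error_square_summable: "square_summable tracking_error"
  unfolding tracking_error_def[abs_def]
  by (intro square_summable_cmult square_summable_add square_summable_sum
      Y_spread_square_summable disagreement_square_summable)

lemma norm_Y_gF_le: "norm (real CARD('a) *\<^sub>R (Y t j $ l) - gF (sbar t) $ l) \<le> tracking_error t"
proof -
  let ?m = "mix.mean l t (\<lambda>i. Y t i $ l)"
  have "norm (Y t j $ l - ?m) \<le> spread (\<lambda>i. Y t i $ l)"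
    by (rule mix.norm_diff_mean_le_spread[of "\<lambda>i. Y t i $ l"])
  also have "\<dots> \<le> (\<Sum>l\<in>UNIV. spread (\<lambda>i. Y t i $ l))"
    by (rule member_le_sum) auto
  finally have deviation: "norm (real CARD('a) *\<^sub>R (Y t j $ l - ?m))
      \<le> real CARD('a) * (\<Sum>l\<in>UNIV. spread (\<lambda>i. Y t i $ l))"
    by simp
  have drift: "norm (\<Sum>i\<in>UNIV. gf i (X t i) $ l - gf i (sbar t) $ l)
      \<le> real CARD('a) * (L * disagreement t)"
    using norm_gf_X_sbar_le by (intro sum_norm_bound) auto
  have "real CARD('a) *\<^sub>R (Y t j $ l) - gF (sbar t) $ l
      = real CARD('a) *\<^sub>R (Y t j $ l - ?m) + (\<Sum>i\<in>UNIV. gf i (X t i) $ l - gf i (sbar t) $ l)"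
    unfolding Y_mean by (simp add: gF_def scaleR_diff_right sum_subtractf)
  then show ?thesis
    using norm_triangle_mono[OF deviation drift] by (simp add: tracking_error_def distrib_left)
qed

lemma norm_tracked_others_gradient_le:
  "norm (tracked_others_gradient t i l - others_gradient i l (sbar t))
    \<le> tracking_error t + L * disagreement t"
proof -
  have "tracked_others_gradient t i l - others_gradient i l (sbar t)
      = (real CARD('a) *\<^sub>R (Y t i $ l) - gF (sbar t) $ l) - (gf i (X t i) $ l - gf i (sbar t) $ l)"
    by (simp add: tracked_others_gradient_def others_gradient_def algebra_simps)
  also have "norm \<dots> \<le> tracking_error t + L * disagreement t"
    by (intro norm_triangle_le_diff add_mono norm_Y_gF_le norm_gf_X_sbar_le)
  finally show ?thesis .
qed

lemma tracking_error_nonneg: "0 \<le> tracking_error t"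
  by (rule order_trans[OF norm_ge_zero norm_Y_gF_le])

subsection \<open>Descent\<close>

text \<open>The regularizer is averaged over the agents instead of being evaluated at \<open>sbar t\<close>: the
  difference of the two is not summable, but the averaged version is monotone under mixing.\<close>

definition lyapunov :: "nat \<Rightarrow> real" where
  "lyapunov t = (\<Sum>i\<in>UNIV. f i (sbar t)) + (\<Sum>l\<in>UNIV. mix.mean l t (\<lambda>j. r l (X t j $ l)))"

lemma objective_le_lyapunov: "objective f r (sbar t) \<le> lyapunov t"
  unfolding objective_def lyapunov_def sbar_nth
  by (intro add_left_mono sum_mono mix.convex_on_mean_le[OF r_convex]) simp

lemma regularizer_descent:
  "mix.mean l (Suc t) (\<lambda>j. r l (X (Suc t) j $ l)) \<le> mix.mean l t (\<lambda>j. r l (X t j $ l))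
    + \<gamma> t * mix.mean l t (\<lambda>j. r l (X t j $ l + \<Delta> t j l) - r l (X t j $ l))"
proof -
  let ?x = "\<lambda>j. X t j $ l" and ?d = "\<lambda>j. \<Delta> t j l"
  have "mix.mean l (Suc t) (\<lambda>i. r l (X (Suc t) i $ l))
      \<le> mix.mean l (Suc t) (\<lambda>i. \<Sum>j\<in>UNIV. mix.weight l t i j *\<^sub>R r l (?x j + \<gamma> t *\<^sub>R ?d j))"
    unfolding X_Suc real_scaleR_def
    by (intro mix.mean_mono convex_on_sum[OF _ _ r_convex mix.weight_sum mix.weight_nonneg]) auto
  also have "\<dots> = mix.mean l t (\<lambda>j. r l (?x j + \<gamma> t *\<^sub>R ?d j))"
    by (rule mix.mean_mix)
  also have "\<dots> \<le> mix.mean l t (\<lambda>j. r l (?x j) + \<gamma> t * (r l (?x j + ?d j) - r l (?x j)))"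
  proof (rule mix.mean_mono)
    show "r l (?x j + \<gamma> t *\<^sub>R ?d j) \<le> r l (?x j) + \<gamma> t * (r l (?x j + ?d j) - r l (?x j))" for j
      using convex_on_segment_le[OF r_convex UNIV_I UNIV_I \<gamma>_nonneg \<gamma>_le1,
          of l "?x j" t "?x j + ?d j"]
      by simp
  qed
  finally show ?thesis
    unfolding mix.mean_add mix.mean_cmult .
qed

lemma smooth_descent:
  "(\<Sum>i\<in>UNIV. f i (sbar (Suc t))) \<le> (\<Sum>i\<in>UNIV. f i (sbar t))
    + \<gamma> t * (\<Sum>l\<in>UNIV. mix.mean l t (\<lambda>j. inner (gF (sbar t) $ l) (\<Delta> t j l)))
    + real CARD('a) * L / 2 * (step_max * \<gamma> t)\<^sup>2"
proof -
  have "inner (gF (sbar t)) (sbar (Suc t) - sbar t)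
      = \<gamma> t * (\<Sum>l\<in>UNIV. mix.mean l t (\<lambda>j. inner (gF (sbar t) $ l) (\<Delta> t j l)))"
    by (subst inner_vec_def) (simp add: sbar_Suc mix.inner_mean sum_distrib_left)
  moreover have "real CARD('a) * L / 2 * (norm (sbar (Suc t) - sbar t))\<^sup>2
      \<le> real CARD('a) * L / 2 * (step_max * \<gamma> t)\<^sup>2"
    using L_nonneg by (intro mult_left_mono power_mono norm_sbar_step_le) auto
  ultimately show ?thesis
    using descent_lemma[OF convex_K gF_deriv gF_lipschitz sbar_in_K sbar_in_K, of "Suc t" t]
    by linarith
qed

lemma direction_descent:
  "inner (gF (sbar t) $ l) (\<Delta> t j l) + (r l (X t j $ l + \<Delta> t j l) - r l (X t j $ l))
    \<le> tracking_error t * \<Delta>_max - \<mu> * (norm (\<Delta> t j l))\<^sup>2"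
proof -
  let ?NY = "real CARD('a) *\<^sub>R (Y t j $ l)"
  have "inner (gF (sbar t) $ l) (\<Delta> t j l) - inner ?NY (\<Delta> t j l)
      \<le> norm (gF (sbar t) $ l - ?NY) * norm (\<Delta> t j l)"
    unfolding inner_diff_left[symmetric] by (rule norm_cauchy_schwarz)
  also have "\<dots> \<le> tracking_error t * \<Delta>_max"
    unfolding norm_minus_commute[of "gF (sbar t) $ l"]
    by (intro mult_mono norm_Y_gF_le norm_\<Delta>_le tracking_error_nonneg norm_ge_zero)
  finally show ?thesis
    using \<Delta>_descent[of t j l] by linarith
qed

definition descent_error :: "nat \<Rightarrow> real" where
  "descent_error t = step_max * (\<gamma> t * tracking_error t)
    + real CARD('a) * L / 2 * (step_max * \<gamma> t)\<^sup>2"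

lemma descent_error_summable: "summable descent_error"
  unfolding descent_error_def[abs_def] power_mult_distrib
  by (intro summable_add summable_mult summable_mult_of_square_summable
      \<gamma>_square_summable tracking_error_square_summable \<gamma>_sq_summable)

lemma descent_error_nonneg: "0 \<le> descent_error t"
  unfolding descent_error_def
  using L_nonneg step_max_nonneg \<gamma>_nonneg tracking_error_nonneg
  by (intro add_nonneg_nonneg mult_nonneg_nonneg) auto

definition direction_energy :: "nat \<Rightarrow> real" where
  "direction_energy t = (\<Sum>l\<in>UNIV. mix.mean l t (\<lambda>j. (norm (\<Delta> t j l))\<^sup>2))"

lemma lyapunov_descent:
  "lyapunov (Suc t) \<le> lyapunov t - \<mu> * \<gamma> t * direction_energy t + descent_error t"
proof -
  let ?R = "\<lambda>t. \<Sum>l\<in>UNIV. mix.mean l t (\<lambda>j. r l (X t j $ l))"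
  let ?inner = "\<Sum>l\<in>UNIV. mix.mean l t (\<lambda>j. inner (gF (sbar t) $ l) (\<Delta> t j l))"
  let ?diff = "\<Sum>l\<in>UNIV. mix.mean l t (\<lambda>j. r l (X t j $ l + \<Delta> t j l) - r l (X t j $ l))"
  have regularizer: "?R (Suc t) \<le> ?R t + \<gamma> t * ?diff"
    unfolding sum_distrib_left sum.distrib[symmetric] by (intro sum_mono regularizer_descent)
  have "?inner + ?diff = (\<Sum>l\<in>UNIV. mix.mean l t (\<lambda>j. inner (gF (sbar t) $ l) (\<Delta> t j l)
      + (r l (X t j $ l + \<Delta> t j l) - r l (X t j $ l))))"
    by (simp add: mix.mean_add sum.distrib)
  also have "\<dots> \<le> (\<Sum>l\<in>UNIV. mix.mean l t (\<lambda>j. tracking_error t * \<Delta>_max - \<mu> * (norm (\<Delta> t j l))\<^sup>2))"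
    by (intro sum_mono mix.mean_mono direction_descent)
  also have "\<dots> = step_max * tracking_error t - \<mu> * direction_energy t"
    by (simp add: direction_energy_def step_max_def mix.mean_diff mix.mean_const mix.mean_cmult
        sum_subtractf sum_distrib_left)
  finally have "\<gamma> t * (?inner + ?diff)
      \<le> \<gamma> t * (step_max * tracking_error t - \<mu> * direction_energy t)"
    by (rule mult_left_mono[OF _ \<gamma>_nonneg])
  then show ?thesis
    using regularizer smooth_descent[of t]
    by (simp add: lyapunov_def descent_error_def algebra_simps)
qed

lemma direction_energy_nonneg: "0 \<le> direction_energy t"
  unfolding direction_energy_def by (intro sum_nonneg mix.mean_nonneg) simp

lemma direction_energy_summable: "summable (\<lambda>t. \<mu> * \<gamma> t * direction_energy t)"
proof -
  have "K \<noteq> {}"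
    using sbar_in_K by blast
  then obtain x where minimal: "\<And>y. y \<in> K \<Longrightarrow> objective f r x \<le> objective f r y"
    using coercive_on_attains_inf[OF closed_K _ objective_continuous objective_coercive]
    by blast
  show ?thesis
  proof (rule summable_of_descent[OF lyapunov_descent descent_error_summable descent_error_nonneg])
    show "objective f r x \<le> lyapunov t" for t
      using minimal[OF sbar_in_K] objective_le_lyapunov by (rule order_trans)
    show "0 \<le> \<mu> * \<gamma> t * direction_energy t" for t
      using \<mu>_pos \<gamma>_nonneg direction_energy_nonneg by simp
  qed
qed

lemma sbar_bounded: "bounded (range sbar)"
proof -
  define c where "c = lyapunov 0 + suminf descent_error"
  have level: "objective f r (sbar t) \<le> c" for t
  proof -
    have "0 \<le> (\<Sum>s<t. \<mu> * \<gamma> s * direction_energy s)"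
      using \<mu>_pos \<gamma>_nonneg direction_energy_nonneg by (intro sum_nonneg) simp
    then show ?thesis
      using sum_le_of_descent[OF lyapunov_descent descent_error_summable descent_error_nonneg, of t]
        objective_le_lyapunov[of t] by (simp add: c_def)
  qed
  obtain R where outside: "\<And>x. x \<in> K \<Longrightarrow> R \<le> norm x \<Longrightarrow> c + 1 \<le> objective f r x"
    using objective_coercive unfolding coercive_on_def by blast
  have "norm (sbar t) \<le> R" for t
    using outside[OF sbar_in_K, of t] level[of t] by linarith
  then show ?thesis
    by (auto simp: bounded_iff)
qed

lemma \<Delta>_weighted_summable: "summable (\<lambda>t. \<gamma> t * (norm (\<Delta> t j l))\<^sup>2)"
proof -
  define c where "c = mix.\<phi>_min l / real CARD('a)"
  have c_pos: "0 < c"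
    by (simp add: c_def mix.\<phi>_min_pos)
  show ?thesis
  proof (rule summable_comparison_test')
    show "summable (\<lambda>t. 1 / (\<mu> * c) * (\<mu> * \<gamma> t * direction_energy t))"
      by (intro summable_mult direction_energy_summable)
    fix t
    have "c * (norm (\<Delta> t j l))\<^sup>2 \<le> mix.mean l t (\<lambda>j. (norm (\<Delta> t j l))\<^sup>2)"
      unfolding c_def by (rule mix.le_mean) simp
    also have "\<dots> \<le> direction_energy t"
      unfolding direction_energy_def by (rule member_le_sum) (auto intro: mix.mean_nonneg)
    finally have "\<gamma> t * (norm (\<Delta> t j l))\<^sup>2 \<le> \<gamma> t * (direction_energy t / c)"
      using c_pos by (intro mult_left_mono \<gamma>_nonneg) (simp add: pos_le_divide_eq mult.commute)
    then show "norm (\<gamma> t * (norm (\<Delta> t j l))\<^sup>2) \<le> 1 / (\<mu> * c) * (\<mu> * \<gamma> t * direction_energy t)"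
      using \<mu>_pos \<gamma>_nonneg by simp
  qed
qed

subsection \<open>Stationarity of limit points\<close>

definition response_error :: "nat \<Rightarrow> real" where
  "response_error t
    = 1 / \<mu> * (Lt * disagreement t + (tracking_error t + L * disagreement t)) + disagreement t"

lemma response_error_square_summable: "square_summable response_error"
  unfolding response_error_def[abs_def]
  by (intro square_summable_add square_summable_cmult disagreement_square_summable
      tracking_error_square_summable)

lemma norm_Xt_response_le:
  "norm (Xt t i - response i (sel t i) (sbar t))
    \<le> 1 / \<mu> * (Lt * disagreement t + (tracking_error t + L * disagreement t))"
proof -
  have "0 \<le> Lt"
    using ft_lipschitz[OF Xt_mem] by (rule lipschitz_on_nonneg)
  have "\<mu> * norm (Xt t i - response i (sel t i) (sbar t)) \<le> Lt * norm (X t i - sbar t)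
      + norm (tracked_others_gradient t i (sel t i) - others_gradient i (sel t i) (sbar t))"
    by (rule best_response_perturbation[OF X_in_K sbar_in_K best_response_Xt
          best_response_response[OF sbar_in_K]])
  also have "\<dots> \<le> Lt * disagreement t + (tracking_error t + L * disagreement t)"
    using \<open>0 \<le> Lt\<close>
    by (intro add_mono mult_left_mono norm_X_sbar_le norm_tracked_others_gradient_le)
  finally show ?thesis
    using \<mu>_pos by (simp add: pos_le_divide_eq mult.commute)
qed

lemma norm_residual_sel_le:
  "norm (residual i (sel t i) (sbar t)) \<le> norm (\<Delta> t i (sel t i)) + response_error t"
proof -
  let ?l = "sel t i"
  have "norm ((X t i - sbar t) $ ?l) \<le> disagreement t"
    by (rule order_trans[OF Finite_Cartesian_Product.norm_nth_le norm_X_sbar_le])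
  then have "norm ((X t i - sbar t) $ ?l - (Xt t i - response i ?l (sbar t))) \<le> response_error t"
    unfolding response_error_def add.commute[of _ "disagreement t"]
    by (intro norm_triangle_le_diff add_mono norm_Xt_response_le)
  from norm_triangle_mono[OF order_refl this, of "\<Delta> t i ?l"] show ?thesis
    by (simp add: residual_def \<Delta>_def)
qed

lemma residual_selected_summable:
  "summable (\<lambda>t. if sel t i = l then \<gamma> t * (norm (residual i l (sbar t)))\<^sup>2 else 0)"
proof (rule summable_comparison_test')
  show "summable (\<lambda>t. 2 * (\<gamma> t * (norm (\<Delta> t i l))\<^sup>2) + 2 * (response_error t)\<^sup>2)"
    using response_error_square_summable unfolding square_summable_def
    by (intro summable_add summable_mult \<Delta>_weighted_summable)
  fix t
  have "\<gamma> t * (norm (residual i l (sbar t)))\<^sup>2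
      \<le> 2 * (\<gamma> t * (norm (\<Delta> t i l))\<^sup>2) + 2 * (response_error t)\<^sup>2" if "sel t i = l"
  proof -
    have "(norm (residual i l (sbar t)))\<^sup>2 \<le> (norm (\<Delta> t i l) + response_error t)\<^sup>2"
      using norm_residual_sel_le[of i t] that by (intro power_mono) auto
    also have "\<dots> \<le> 2 * (norm (\<Delta> t i l))\<^sup>2 + 2 * (response_error t)\<^sup>2"
      by (rule power2_add_le)
    finally have "\<gamma> t * (norm (residual i l (sbar t)))\<^sup>2
        \<le> \<gamma> t * (2 * (norm (\<Delta> t i l))\<^sup>2) + \<gamma> t * (2 * (response_error t)\<^sup>2)"
      unfolding distrib_left[symmetric] by (rule mult_left_mono[OF _ \<gamma>_nonneg])
    also have "\<gamma> t * (2 * (response_error t)\<^sup>2) \<le> 1 * (2 * (response_error t)\<^sup>2)"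
      by (intro mult_right_mono \<gamma>_le1) simp
    finally show ?thesis
      by simp
  qed
  then show "norm (if sel t i = l then \<gamma> t * (norm (residual i l (sbar t)))\<^sup>2 else 0)
      \<le> 2 * (\<gamma> t * (norm (\<Delta> t i l))\<^sup>2) + 2 * (response_error t)\<^sup>2"
    by (simp add: \<gamma>_nonneg)
qed

lemma dist_norm_residual_step_le:
  "dist (norm (residual i l (sbar t))) (norm (residual i l (sbar (Suc t))))
    \<le> residual_lip * step_max * \<gamma> t"
proof -
  have "dist (norm (residual i l (sbar t))) (norm (residual i l (sbar (Suc t))))
      \<le> norm (residual i l (sbar (Suc t)) - residual i l (sbar t))"
    using norm_triangle_ineq3[of "residual i l (sbar (Suc t))" "residual i l (sbar t)"]
    by (simp add: dist_real_def abs_minus_commute)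
  also have "\<dots> \<le> residual_lip * norm (sbar (Suc t) - sbar t)"
    by (rule lipschitz_on_normD[OF residual_lipschitz sbar_in_K sbar_in_K])
  also have "\<dots> \<le> residual_lip * (step_max * \<gamma> t)"
    by (intro mult_left_mono norm_sbar_step_le lipschitz_on_nonneg[OF residual_lipschitz])
  finally show ?thesis
    by (simp add: mult.assoc)
qed

lemma residual_tendsto_zero: "(\<lambda>t. norm (residual i l (sbar t))) \<longlonglongrightarrow> 0"
proof -
  have rate: "0 \<le> residual_lip * step_max"
    using lipschitz_on_nonneg[OF residual_lipschitz] step_max_nonneg by simp
  have "summable (\<lambda>t. \<gamma> t * (norm (residual i l (sbar t)))\<^sup>2)"
  proof (rule weighted_square_summable_of_windowed[where S = "{t. sel t i = l}"])
    show "\<exists>s<T. t + s \<in> {t. sel t i = l}" for t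
      using sel_window by simp
    show "summable (\<lambda>t. if t \<in> {t. sel t i = l} then \<gamma> t * (norm (residual i l (sbar t)))\<^sup>2 else 0)"
      using residual_selected_summable by simp
  qed (rule norm_ge_zero \<gamma>_nonneg \<gamma>_le1 \<gamma>_decseq \<gamma>_square_summable dist_norm_residual_step_le rate)+
  then show ?thesis
    by (rule tendsto_zero_of_weighted_square_summable[OF norm_ge_zero \<gamma>_nonneg \<gamma>_le1
          \<gamma>_not_summable \<gamma>_square_summable _ dist_norm_residual_step_le rate])
qed

lemma limit_point_stationary:
  assumes subsequence: "strict_mono \<sigma>" and lim: "(sbar \<circ> \<sigma>) \<longlonglongrightarrow> x"
  shows "stationary gf r Kb x"
proof -
  have x_mem: "x \<in> K"
    by (rule closed_sequentially[OF closed_K _ lim]) (simp add: sbar_in_K)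
  have "residual i l x = 0" for i l
  proof -
    have "((\<lambda>n. residual i l ((sbar \<circ> \<sigma>) n)) \<longlongrightarrow> residual i l x) sequentially"
      by (rule continuous_on_tendsto_compose
          [OF lipschitz_on_continuous_on[OF residual_lipschitz] lim x_mem])
        (simp add: sbar_in_K)
    then have "(\<lambda>n. norm (residual i l (sbar (\<sigma> n)))) \<longlonglongrightarrow> norm (residual i l x)"
      by (simp add: tendsto_norm)
    moreover have "(\<lambda>n. norm (residual i l (sbar (\<sigma> n)))) \<longlonglongrightarrow> 0"
      using LIMSEQ_subseq_LIMSEQ[OF residual_tendsto_zero subsequence] by (simp add: comp_def)
    ultimately show ?thesis
      using LIMSEQ_unique by fastforce
  qed
  then show ?thesis
    by (rule stationary_of_residual_zero[OF x_mem])
qed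

end

theorem theorem1:
  fixes f :: "'a::finite \<Rightarrow> real^'d::finite^'b::finite \<Rightarrow> real"
    and gf :: "'a \<Rightarrow> real^'d^'b \<Rightarrow> real^'d^'b"
    and r :: "'b \<Rightarrow> real^'d \<Rightarrow> real"
    and Kb :: "'b \<Rightarrow> (real^'d) set"
    and E :: "('a \<times> 'a) set"
    and sel :: "nat \<Rightarrow> 'a \<Rightarrow> 'b"
    and A :: "'b \<Rightarrow> nat \<Rightarrow> 'a \<Rightarrow> 'a \<Rightarrow> real"
    and \<kappa> :: real
    and ft :: "'a \<Rightarrow> 'b \<Rightarrow> real^'d \<Rightarrow> real^'d^'b \<Rightarrow> real"
    and gft :: "'a \<Rightarrow> 'b \<Rightarrow> real^'d \<Rightarrow> real^'d^'b \<Rightarrow> real^'d"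
    and \<tau> :: "'a \<Rightarrow> real"
    and \<gamma> :: "nat \<Rightarrow> real"
    and X Y :: "nat \<Rightarrow> 'a \<Rightarrow> real^'d^'b"
    and \<Phi> :: "nat \<Rightarrow> 'a \<Rightarrow> 'b \<Rightarrow> real"
    and Xt :: "nat \<Rightarrow> 'a \<Rightarrow> real^'d"
  defines "K \<equiv> prod_set Kb"
    and "U \<equiv> (\<lambda>x. (\<Sum>i\<in>UNIV. f i x) + (\<Sum>l\<in>UNIV. r l (x $ l)))"
    and "fhat \<equiv> (\<lambda>i l z w g. ft i l z w + inner (real CARD('a) *\<^sub>R g - gf i w $ l) (z - w $ l))"
    and "sbar \<equiv> (\<lambda>t. (1 / real CARD('a)) *\<^sub>R (\<chi> l. \<Sum>i\<in>UNIV. \<Phi> t i l *\<^sub>R (X t i $ l)))"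
  \<comment> \<open>problem assumptions\<close>
  assumes K_ne: "\<And>l. Kb l \<noteq> {}"
    and K_closed: "\<And>l. closed (Kb l)"
    and K_convex: "\<And>l. convex (Kb l)"
    and f_C1: "\<exists>S. open S \<and> K \<subseteq> S \<and>
                 (\<forall>i. (\<forall>x\<in>S. GDERIV (f i) x :> gf i x) \<and> continuous_on S (gf i))"
    and gf_lip: "\<And>i. \<exists>L. L-lipschitz_on K (gf i)"
    and gf_bdd: "\<And>i. bounded (gf i ` K)"
    and r_convex: "\<And>l. convex_on UNIV (r l)"
    and r_subgrad_bdd: "\<And>l. \<exists>M. \<forall>z\<in>Kb l. \<forall>g. is_subgradient (r l) z g \<longrightarrow> norm g \<le> M"
    and U_coercive: "coercive_on K U"
  \<comment> \<open>network\<close>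
    and E_strong: "\<And>i j. (i, j) \<in> E\<^sup>*"
    and E_loops: "\<And>i. (i, i) \<in> E"
  \<comment> \<open>block selection\<close>
    and sel_ess_cyclic: "\<And>i. \<exists>T>0. \<forall>t. (\<Union>s<T. {sel (t + s) i}) = UNIV"
  \<comment> \<open>weights\<close>
    and \<kappa>_pos: "\<kappa> > 0"
    and A_pos: "\<And>l t i j. (j, i) \<in> edges_block E (sel t) l \<Longrightarrow> A l t i j > \<kappa>"
    and A_zero: "\<And>l t i j. (j, i) \<notin> edges_block E (sel t) l \<Longrightarrow> A l t i j = 0"
    and A_colstoch: "\<And>l t j. (\<Sum>i\<in>UNIV. A l t i j) = 1"
  \<comment> \<open>surrogates\<close>
    and \<tau>_pos: "\<And>i. \<tau> i > 0"
    and ft_deriv: "\<And>i l x z. x \<in> K \<Longrightarrow> z \<in> Kb l \<Longrightarrow> GDERIV (\<lambda>z. ft i l z x) z :> gft i l z x"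
    and ft_C1: "\<And>i l x. x \<in> K \<Longrightarrow> continuous_on (Kb l) (\<lambda>z. gft i l z x)"
    and ft_strong: "\<And>i l x. x \<in> K \<Longrightarrow> strongly_convex_on (\<tau> i) (Kb l) (\<lambda>z. ft i l z x)"
    and ft_grad_cons: "\<And>i l x. x \<in> K \<Longrightarrow> gft i l (x $ l) x = gf i x $ l"
    and ft_lip: "\<And>i l. \<exists>L. \<forall>z\<in>Kb l. L-lipschitz_on K (\<lambda>x. gft i l z x)"
  \<comment> \<open>step sizes\<close>
    and \<gamma>_pos: "\<And>t. 0 < \<gamma> t" and \<gamma>_le1: "\<And>t. \<gamma> t \<le> 1"
    and \<gamma>_decr: "\<And>t. \<gamma> (Suc t) \<le> \<gamma> t"
    and \<gamma>_not_summable: "\<not> summable \<gamma>"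
    and \<gamma>_sq_summable: "summable (\<lambda>t. (\<gamma> t)\<^sup>2)"
  \<comment> \<open>the algorithm\<close>
    and init_X: "\<And>i. X 0 i \<in> K"
    and init_Y: "\<And>i. Y 0 i = gf i (X 0 i)"
    and init_\<Phi>: "\<And>i l. \<Phi> 0 i l = 1"
    and Xt_mem: "\<And>t i. Xt t i \<in> Kb (sel t i)"
    and Xt_min: "\<And>t i z. z \<in> Kb (sel t i) \<Longrightarrow>
        fhat i (sel t i) (Xt t i) (X t i) (Y t i $ sel t i) + r (sel t i) (Xt t i)
          \<le> fhat i (sel t i) z (X t i) (Y t i $ sel t i) + r (sel t i) z"
    and upd_\<Phi>: "\<And>t i l. \<Phi> (Suc t) i l =
        (\<Sum>j\<in>nbr_block E (sel t) i l. A l t i j * \<Phi> t j l)"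
    and upd_X: "\<And>t i l. X (Suc t) i $ l =
        (\<Sum>j\<in>nbr_block E (sel t) i l. (A l t i j * \<Phi> t j l / \<Phi> (Suc t) i l) *\<^sub>R
           (X t j $ l + \<gamma> t *\<^sub>R (if l = sel t j then Xt t j - X t j $ l else 0)))"
    and upd_Y: "\<And>t i l. Y (Suc t) i $ l =
        (\<Sum>j\<in>nbr_block E (sel t) i l. (A l t i j / \<Phi> (Suc t) i l) *\<^sub>R
           (\<Phi> t j l *\<^sub>R (Y t j $ l) + gf j (X (Suc t) j) $ l - gf j (X t j) $ l))"
  shows "(\<forall>i. (\<lambda>t. norm (X t i - sbar t)) \<longlonglongrightarrow> 0)
       \<and> bounded (range sbar)
       \<and> (\<forall>xs. (\<exists>\<sigma>. strict_mono \<sigma> \<and> (sbar \<circ> \<sigma>) \<longlonglongrightarrow> xs) \<longrightarrow> stationary gf r Kb xs)"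
proof -
  have f_deriv: "\<And>i x. x \<in> K \<Longrightarrow> GDERIV (f i) x :> gf i x"
    using f_C1 by blast
  obtain L where gf_lipschitz: "\<And>i. L-lipschitz_on K (gf i)"
    using uniform_lipschitz_on[of K gf] gf_lip by blast
  obtain Lt where gft_lipschitz: "\<And>i l z. z \<in> Kb l \<Longrightarrow> Lt-lipschitz_on K (gft i l z)"
    using uniform_lipschitz_on_family[of Kb K gft] ft_lip by blast
  obtain G where gf_bound: "\<And>i x. x \<in> K \<Longrightarrow> norm (gf i x) \<le> G"
    using uniform_bound_on[of gf K] gf_bdd by blast
  obtain M where r_bound: "\<And>l z y. z \<in> Kb l \<Longrightarrow> r l z - r l y \<le> M * norm (z - y)"
    using uniform_diff_le_of_subgradient_bound[of r Kb] r_convex r_subgrad_bdd by blast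
  obtain \<mu> where \<mu>_pos: "0 < \<mu>"
      and ft_convex: "\<And>i l x. x \<in> K \<Longrightarrow> strongly_convex_on \<mu> (Kb l) (\<lambda>z. ft i l z x)"
    using uniform_positive_lower_bound[of \<tau>] \<tau>_pos strongly_convex_on_mono[OF ft_strong] by blast
  obtain T where sel_window: "\<And>t i l. \<exists>s<T. sel (t + s) i = l"
    using uniform_window[of sel, OF sel_ess_cyclic] by metis
  interpret alg: block_gradient_tracking f gf r Kb L ft gft \<mu> Lt G M E sel T A \<kappa> \<gamma> X Y \<Phi> Xt
    by (unfold_locales, fold K_def, unfold objective_def[abs_def], fold U_def)
      (fact K_ne K_closed K_convex f_deriv gf_lipschitz r_convex \<mu>_pos ft_deriv ft_convex
        ft_grad_cons gft_lipschitz gf_bound r_bound U_coercive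
        E_strong E_loops sel_window \<kappa>_pos A_pos A_zero
        A_colstoch \<gamma>_pos \<gamma>_le1 \<gamma>_decr \<gamma>_not_summable \<gamma>_sq_summable init_X init_Y init_\<Phi> Xt_mem
        Xt_min[unfolded fhat_def] upd_\<Phi> upd_X upd_Y)+
  have "sbar = alg.sbar"
    by (simp add: fun_eq_iff vec_eq_iff sbar_def alg.sbar_nth alg.mix.mean_def scaleR_sum_right)
  then show ?thesis
    using alg.consensus alg.sbar_bounded alg.limit_point_stationary by blast
qed

end
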